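(* Let $K, L\subset\mathbb{R}^n$ be convex bodies and suppose that $L_s=PUL+z$, with $P\in\mathcal{P}^n$, $U\in O_n$, $z\in\mathbb{R}^n$, is a saddle-John image of $L$ inside $K$. Then there exists $a\in\mathbb{R}^n$ such that $K-a\subset -n(L_s-a)$.
   Context: A convex body is a compact convex set with nonempty interior. $\mathcal{P}^n$ is the set of symmetric positive-definite $n\times n$ real matrices and $O_n$ the orthogonal group. A positive image of $M$ in $K$ is a set $QM+w\subset K$ with $Q\in\mathcal{P}^n$, $w\in\mathbb{R}^n$; the positive John image of $M$ in $K$ is the unique positive image of $M$ in $K$ of maximal volume, and the pair $(Q,w)$ realizing it is unique. For $V\in O_n$ let $(P^*(V),z^*(V))$ be the unique pair such that $P^*(V)VL+z^*(V)$ is the positive John image of $VL$ in $K$. The body $PUL+z$ is a saddle-John image of $L$ inside $K$ if $(P^*(U),z^*(U))=(P,z)$ and $\det P^*(V)\ge\det P$ for all $V\in O_n$ (such an image need not be unique). *)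

theory Defs
  imports "HOL-Analysis.Analysis"
begin

definition convex_body :: "(real ^ 'n) set \<Rightarrow> bool" where
  "convex_body K \<longleftrightarrow> compact K \<and> convex K \<and> interior K \<noteq> {}"

definition pos_def :: "real ^ 'n ^ 'n \<Rightarrow> bool" where
  "pos_def Q \<longleftrightarrow> transpose Q = Q \<and> (\<forall>x. x \<noteq> 0 \<longrightarrow> x \<bullet> (Q *v x) > 0)"

definition affine_image :: "real ^ 'n ^ 'n \<Rightarrow> real ^ 'n \<Rightarrow> (real ^ 'n) set \<Rightarrow> (real ^ 'n) set" where
  "affine_image Q w M = (\<lambda>x. Q *v x + w) ` M"

definition positive_image :: "(real ^ 'n) set \<Rightarrow> (real ^ 'n) set \<Rightarrow> (real ^ 'n) set \<Rightarrow> bool" where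
  "positive_image K M S \<longleftrightarrow> (\<exists>Q w. pos_def Q \<and> S = affine_image Q w M \<and> S \<subseteq> K)"

definition positive_John_image :: "(real ^ 'n) set \<Rightarrow> (real ^ 'n) set \<Rightarrow> (real ^ 'n) set \<Rightarrow> bool" where
  "positive_John_image K M S \<longleftrightarrow>
     positive_image K M S \<and>
     (\<forall>S'. positive_image K M S' \<longrightarrow> measure lebesgue S' \<le> measure lebesgue S)"

text \<open>
  For convex bodies \<open>K\<close> and \<open>L\<close> and orthogonal \<open>V\<close> there is exactly one pair as described
  below; outside this situation the value is unspecified.
\<close>

definition John_pair ::
  "(real ^ 'n) set \<Rightarrow> (real ^ 'n) set \<Rightarrow> real ^ 'n ^ 'n \<Rightarrow> (real ^ 'n ^ 'n) \<times> (real ^ 'n)" where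
  "John_pair K L V =
     (THE (Q, w). pos_def Q \<and>
        positive_John_image K ((\<lambda>x. V *v x) ` L) (affine_image Q w ((\<lambda>x. V *v x) ` L)))"

definition P_star :: "(real ^ 'n) set \<Rightarrow> (real ^ 'n) set \<Rightarrow> real ^ 'n ^ 'n \<Rightarrow> real ^ 'n ^ 'n" where
  "P_star K L V = fst (John_pair K L V)"

definition z_star :: "(real ^ 'n) set \<Rightarrow> (real ^ 'n) set \<Rightarrow> real ^ 'n ^ 'n \<Rightarrow> real ^ 'n" where
  "z_star K L V = snd (John_pair K L V)"

text \<open>
  Being a saddle-John image is a property of the data \<open>(P, U, z)\<close>; the body itself is
  \<open>P U L + z\<close>.
\<close>

definition saddle_John ::
  "(real ^ 'n) set \<Rightarrow> (real ^ 'n) set \<Rightarrow>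
   real ^ 'n ^ 'n \<Rightarrow> real ^ 'n ^ 'n \<Rightarrow> real ^ 'n \<Rightarrow> bool" where
  "saddle_John K L P U z \<longleftrightarrow>
     pos_def P \<and> orthogonal_matrix U \<and>
     (P_star K L U, z_star K L U) = (P, z) \<and>
     (\<forall>V. orthogonal_matrix V \<longrightarrow> det (P_star K L V) \<ge> det P)"

end

theory Submission
  imports Defs
begin

text \<open>
  Maximality of \<open>P M + z\<close>, with \<open>M = U L\<close>, among positive images gives a John decomposition: contact
  points \<open>x\<close>, outer normals \<open>u\<close> and weights \<open>c\<close> with \<open>\<Sum> c u = 0\<close> such that
  \<open>N = n \<Sum> c (P\<inverse> (x - k)) u\<^sup>T\<close> has symmetric part \<open>P\<inverse>\<close>. The saddle condition forces \<open>N = P\<inverse>\<close>: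
  otherwise \<open>\<bar>det N\<bar> > det P\<inverse>\<close>, and for the polar decomposition \<open>R N = H\<close> the John pair \<open>(Q, w)\<close> of
  \<open>R U L\<close>, which has \<open>det Q \<ge> det P\<close>, satisfies \<open>trace (Q H) \<le> n\<close> by testing \<open>Q R M + w \<subseteq> K\<close> against the
  normals, whereas \<open>trace (Q H) \<ge> n + ln (det Q * det H) > n\<close> by the arithmetic-geometric mean inequality.
  Hence \<open>n \<Sum> c x u\<^sup>T\<close> is the identity. For \<open>y \<in> K\<close> the convex combination
  \<open>\<Sum> c \<langle>x - y, u\<rangle> x = m - y / n\<close>, where \<open>m = \<Sum> c \<langle>x, u\<rangle> x\<close>, lies in the saddle-John image, and
  \<open>a = n m / (n + 1)\<close> is the required centre.
\<close>

section \<open>Positive definite matrices\<close>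

definition diag_matrix :: "('n \<Rightarrow> real) \<Rightarrow> real ^ 'n ^ 'n" where
  "diag_matrix d = (\<chi> i j. if i = j then d i else 0)"

lemma det_diag_matrix: "det (diag_matrix d) = prod d UNIV"
  unfolding diag_matrix_def by (subst det_diagonal) auto

lemma diag_matrix_mult: "diag_matrix c ** diag_matrix d = diag_matrix (\<lambda>i. c i * d i)"
  by (simp add: diag_matrix_def matrix_matrix_mult_def vec_eq_iff mult_delta_left mult_delta_right)

lemma diag_matrix_1: "diag_matrix (\<lambda>_. 1) = mat 1"
  by (simp add: diag_matrix_def mat_def)

lemma trace_diag_matrix: "trace (diag_matrix d) = sum d UNIV"
  by (simp add: diag_matrix_def trace_def)

lemma transpose_diag_matrix: "transpose (diag_matrix d) = diag_matrix d"
  by (auto simp: diag_matrix_def transpose_def vec_eq_iff)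

lemma conjugate_nth:
  fixes A :: "real ^ 'n ^ 'n"
  shows "(R ** A ** transpose R) $ i $ j = R $ i \<bullet> (A *v R $ j)"
proof -
  have "(R ** A ** transpose R) $ i $ j = (\<Sum>k\<in>UNIV. \<Sum>l\<in>UNIV. R $ i $ l * A $ l $ k * R $ j $ k)"
    by (simp add: matrix_matrix_mult_def transpose_def sum_distrib_right)
  also have "\<dots> = (\<Sum>l\<in>UNIV. \<Sum>k\<in>UNIV. R $ i $ l * A $ l $ k * R $ j $ k)"
    by (rule sum.swap)
  also have "\<dots> = R $ i \<bullet> (A *v R $ j)"
    by (simp add: inner_vec_def matrix_vector_mult_def sum_distrib_left mult.assoc)
  finally show ?thesis .
qed

lemma symmetric_inner:
  assumes "transpose A = (A :: real ^ 'n ^ 'n)"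
  shows "x \<bullet> (A *v y) = y \<bullet> (A *v x)"
  using dot_lmul_matrix[of x A y] transpose_matrix_vector[of A x] by (simp add: assms inner_commute)

lemma inner_vector_matrix_mult:
  "x \<bullet> (y v* A) = (A *v x) \<bullet> (y :: real ^ 'n)"
  by (metis dot_lmul_matrix inner_commute)

lemma matrix_add_rdistrib: "(A + B) ** C = A ** C + B ** (C :: real ^ 'n ^ 'm)"
  by (simp add: matrix_matrix_mult_def vec_eq_iff algebra_simps sum.distrib)

lemma matrix_diff_rdistrib: "(A - B) ** C = A ** C - B ** (C :: real ^ 'n ^ 'm)"
  by (simp add: matrix_matrix_mult_def vec_eq_iff algebra_simps sum_subtractf)

lemma orthogonal_matrix_rows:
  "orthogonal_matrix (R :: real ^ 'n ^ 'n) \<longleftrightarrow> (\<forall>i j. R $ i \<bullet> R $ j = (if i = j then 1 else 0))"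
proof -
  have "orthogonal_matrix R \<longleftrightarrow> R ** transpose R = mat 1"
    by (metis matrix_left_right_inverse orthogonal_matrix)
  also have "R ** transpose R = (\<chi> i j. R $ i \<bullet> R $ j)"
    by (simp add: matrix_matrix_mult_def transpose_def inner_vec_def)
  also have "\<dots> = mat 1 \<longleftrightarrow> (\<forall>i j. R $ i \<bullet> R $ j = (if i = j then 1 else 0))"
    by (simp add: mat_def vec_eq_iff)
  finally show ?thesis .
qed

section \<open>Orthogonal diagonalisation of symmetric matrices\<close>

lemma compact_orthogonal_matrices: "compact {R :: real ^ 'n ^ 'n. orthogonal_matrix R}"
proof -
  have "bounded {R :: real ^ 'n ^ 'n. orthogonal_matrix R}"
  proof (rule boundedI)
    fix R :: "real ^ 'n ^ 'n" assume "R \<in> {R. orthogonal_matrix R}"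
    hence "norm (R $ i) = 1" for i
      by (simp add: orthogonal_matrix_rows norm_eq_sqrt_inner)
    thus "norm R \<le> sqrt (real CARD('n))"
      by (simp add: norm_vec_def L2_set_def)
  qed
  moreover have "closed {R :: real ^ 'n ^ 'n. \<forall>i j. R $ i \<bullet> R $ j = (if i = j then 1 else 0)}"
    by (intro closed_Collect_all closed_Collect_eq continuous_intros)
  ultimately show ?thesis
    by (simp add: compact_eq_bounded_closed orthogonal_matrix_rows)
qed

text \<open>A maximiser of \<open>\<Sum>i. w i * (R A R\<^sup>T) $ i $ i\<close> over orthogonal \<open>R\<close>, with distinct weights,
  diagonalises \<open>A\<close>: otherwise a small plane rotation of two rows increases the sum.\<close>

lemma spectral_theorem_rows:
  fixes A :: "real ^ 'n ^ 'n"
  assumes sym: "transpose A = A"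
  obtains R where "orthogonal_matrix R" "\<And>i j. i \<noteq> j \<Longrightarrow> R $ i \<bullet> (A *v R $ j) = 0"
proof -
  obtain w :: "'n \<Rightarrow> nat" where w: "inj w"
    using finite_imp_inj_to_nat_seg[of "UNIV :: 'n set"] by auto
  define F where "F R = (\<Sum>i\<in>UNIV. real (w i) * (R $ i \<bullet> (A *v R $ i)))" for R :: "real ^ 'n ^ 'n"
  have "continuous_on {R. orthogonal_matrix R} F"
    unfolding F_def
    by (intro continuous_intros matrix_vector_mult_linear_continuous_on[THEN continuous_on_compose2]) auto
  then obtain R where R: "orthogonal_matrix R" and max: "\<And>R'. orthogonal_matrix R' \<Longrightarrow> F R' \<le> F R"
    using continuous_attains_sup[OF compact_orthogonal_matrices, of F] orthogonal_matrix_id by blast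
  have "R $ i \<bullet> (A *v R $ j) = 0" if ij: "i \<noteq> j" for i j
  proof -
    define r where "r = (\<lambda>k. R $ k)"
    define b where "b k l = r k \<bullet> (A *v r l)" for k l
    have bsym: "b k l = b l k" for k l
      unfolding b_def by (rule symmetric_inner[OF sym])
    have ON: "r k \<bullet> r l = (if k = l then 1 else 0)" for k l
      using R by (simp add: orthogonal_matrix_rows r_def)
    define \<Delta> where "\<Delta> = real (w i) - real (w j)"
    \<comment> \<open>\<open>g \<theta>\<close> is \<open>F R' - F R\<close> for the rotation by
      \<theta> in the plane of the rows \<open>i\<close> and \<open>j\<close>. Its derivative at 0
      is twice \<Delta> times the off-diagonal entry, and \<Delta> is nonzero because the weights
      are distinct.\<close>
    define g where "g \<theta> = (sin \<theta>)\<^sup>2 * (\<Delta> * (b j j - b i i)) + 2 * sin \<theta> * cos \<theta> * (\<Delta> * b i j)" for \<theta>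
    have "g \<theta> \<le> 0" for \<theta>
    proof -
      define R' :: "real ^ 'n ^ 'n" where
        "R' = (\<chi> k. if k = i then cos \<theta> *\<^sub>R r i + sin \<theta> *\<^sub>R r j
                   else if k = j then - sin \<theta> *\<^sub>R r i + cos \<theta> *\<^sub>R r j else r k)"
      have sc: "cos \<theta> * cos \<theta> + sin \<theta> * sin \<theta> = 1" "sin \<theta> * sin \<theta> + cos \<theta> * cos \<theta> = 1"
        using sin_cos_squared_add[of \<theta>] by (simp_all add: power2_eq_square)
      have "orthogonal_matrix R'"
        unfolding orthogonal_matrix_rows R'_def using ij
        by (auto simp: inner_add_left inner_add_right inner_diff_left inner_diff_right ON sc)
      hence le: "F R' \<le> F R" by (rule max)
      have U: "(UNIV :: 'n set) = insert i (insert j (UNIV - {i, j}))" by auto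
      have split: "F S = real (w i) * (S $ i \<bullet> (A *v S $ i)) + real (w j) * (S $ j \<bullet> (A *v S $ j))
            + (\<Sum>k\<in>UNIV - {i, j}. real (w k) * (S $ k \<bullet> (A *v S $ k)))" for S
        unfolding F_def by (subst U) (use ij in simp)
      have rest: "(\<Sum>k\<in>UNIV - {i, j}. real (w k) * (R' $ k \<bullet> (A *v R' $ k)))
                 = (\<Sum>k\<in>UNIV - {i, j}. real (w k) * (R $ k \<bullet> (A *v R $ k)))"
        by (rule sum.cong) (auto simp: R'_def r_def)
      have i: "R' $ i \<bullet> (A *v R' $ i) = (cos \<theta>)\<^sup>2 * b i i + 2 * cos \<theta> * sin \<theta> * b i j + (sin \<theta>)\<^sup>2 * b j j"
        using bsym[of j i]
        by (simp add: R'_def matrix_vector_right_distrib matrix_vector_mult_scaleR inner_add_left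
            inner_add_right b_def[symmetric] algebra_simps power2_eq_square)
      have j: "R' $ j \<bullet> (A *v R' $ j) = (sin \<theta>)\<^sup>2 * b i i - 2 * cos \<theta> * sin \<theta> * b i j + (cos \<theta>)\<^sup>2 * b j j"
        using bsym[of j i] ij
        by (simp add: R'_def matrix_vector_right_distrib matrix_vector_mult_diff_distrib matrix_vector_mult_scaleR inner_add_left
            inner_add_right inner_diff_left inner_diff_right b_def[symmetric] algebra_simps power2_eq_square)
      have "real (w i) * b i i + real (w j) * b j j \<ge>
          real (w i) * ((cos \<theta>)\<^sup>2 * b i i + 2 * cos \<theta> * sin \<theta> * b i j + (sin \<theta>)\<^sup>2 * b j j)
          + real (w j) * ((sin \<theta>)\<^sup>2 * b i i - 2 * cos \<theta> * sin \<theta> * b i j + (cos \<theta>)\<^sup>2 * b j j)"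
        using le unfolding split rest i j by (simp add: b_def r_def)
      thus ?thesis
        unfolding g_def \<Delta>_def cos_squared_eq by (simp add: algebra_simps)
    qed
    moreover have "(g has_real_derivative 2 * (\<Delta> * b i j)) (at 0)"
      unfolding g_def by (auto intro!: derivative_eq_intros)
    moreover have "g 0 = 0" by (simp add: g_def)
    ultimately have "2 * (\<Delta> * b i j) = 0"
      by (intro DERIV_local_max[of g _ 0 1]) auto
    moreover have "\<Delta> \<noteq> 0" using w ij by (auto simp: \<Delta>_def dest: injD)
    ultimately show ?thesis by (simp add: b_def r_def)
  qed
  from that[OF R this] show ?thesis .
qed

theorem spectral_theorem:
  fixes A :: "real ^ 'n ^ 'n"
  assumes sym: "transpose A = A"
  obtains R d where "orthogonal_matrix R" "A = transpose R ** diag_matrix d ** R"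
    "\<And>i. d i = R $ i \<bullet> (A *v R $ i)"
proof -
  obtain R where R: "orthogonal_matrix R" and off: "\<And>i j. i \<noteq> j \<Longrightarrow> R $ i \<bullet> (A *v R $ j) = 0"
    by (rule spectral_theorem_rows[OF sym]) blast
  define d where "d i = R $ i \<bullet> (A *v R $ i)" for i
  have "R ** A ** transpose R = diag_matrix d"
    using off by (simp add: vec_eq_iff conjugate_nth diag_matrix_def d_def)
  hence "transpose R ** diag_matrix d ** R = (transpose R ** R) ** A ** (transpose R ** R)"
    by (metis matrix_mul_assoc)
  also have "\<dots> = A" using R by (simp add: orthogonal_matrix)
  finally show ?thesis using that[OF R _ d_def] by metis
qed

lemma pos_def_spectral:
  fixes A :: "real ^ 'n ^ 'n"
  assumes "pos_def A"
  obtains R d where "orthogonal_matrix R" "A = transpose R ** diag_matrix d ** R" "\<And>i. d i > 0"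
proof -
  obtain R d where R: "orthogonal_matrix R" "A = transpose R ** diag_matrix d ** R"
    and d: "\<And>i. d i = R $ i \<bullet> (A *v R $ i)"
    using spectral_theorem assms unfolding pos_def_def by metis
  have "R $ i \<noteq> 0" for i
    using R(1) unfolding orthogonal_matrix_rows by (metis inner_zero_left zero_neq_one)
  with R that d assms show ?thesis unfolding pos_def_def by metis
qed

lemma orthogonal_matrix_conjugate:
  fixes R :: "real ^ 'n ^ 'n"
  assumes R: "orthogonal_matrix R"
  shows "det (transpose R ** A ** R) = det A" "trace (transpose R ** A ** R) = trace A"
    "(transpose R ** A ** R) ** (transpose R ** B ** R) = transpose R ** (A ** B) ** R"
proof -
  have RR: "R ** transpose R = mat 1" using R by (simp add: orthogonal_matrix_def)
  hence "det R * det R = 1" by (metis det_mul det_transpose det_I)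
  thus "det (transpose R ** A ** R) = det A" by (simp add: det_mul)
  have "trace (transpose R ** A ** R) = trace (R ** (transpose R ** A))"
    by (metis trace_mul_sym matrix_mul_assoc)
  thus "trace (transpose R ** A ** R) = trace A" by (simp add: matrix_mul_assoc RR)
  have "(transpose R ** A ** R) ** (transpose R ** B ** R) = transpose R ** A ** (R ** transpose R) ** B ** R"
    by (simp add: matrix_mul_assoc)
  thus "(transpose R ** A ** R) ** (transpose R ** B ** R) = transpose R ** (A ** B) ** R"
    by (simp add: RR matrix_mul_assoc)
qed

lemma pos_def_det_pos:
  assumes "pos_def A"
  shows "det A > 0"
proof -
  obtain R d where "orthogonal_matrix R" "A = transpose R ** diag_matrix d ** R" "\<And>i. d i > 0"
    by (rule pos_def_spectral[OF assms]) blast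
  thus ?thesis by (simp add: orthogonal_matrix_conjugate det_diag_matrix prod_pos)
qed

lemma pos_def_invertible: "pos_def A \<Longrightarrow> invertible A"
  using pos_def_det_pos[of A] by (simp add: invertible_det_nz)

lemma pos_def_congruence:
  fixes G :: "real ^ 'n ^ 'n"
  assumes "pos_def A" "invertible G"
  shows "pos_def (transpose G ** A ** G)"
  unfolding pos_def_def
proof (intro conjI allI impI)
  show "transpose (transpose G ** A ** G) = transpose G ** A ** G"
    using assms(1) by (simp add: pos_def_def matrix_transpose_mul matrix_mul_assoc)
  fix x :: "real ^ 'n" assume "x \<noteq> 0"
  moreover have "inj ((*v) G)"
    using assms(2) by (metis invertible_left_inverse matrix_left_invertible_injective)
  ultimately have "G *v x \<noteq> 0" by (metis injD matrix_vector_mult_0_right)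
  hence "(G *v x) \<bullet> (A *v (G *v x)) > 0" using assms(1) by (simp add: pos_def_def)
  thus "x \<bullet> (transpose G ** A ** G *v x) > 0"
    by (metis dot_lmul_matrix matrix_vector_mul_assoc transpose_matrix_vector transpose_transpose)
qed

lemma pos_def_diag_matrix:
  fixes d :: "'n::finite \<Rightarrow> real"
  assumes d: "\<And>i. d i > 0"
  shows "pos_def (diag_matrix d)"
proof -
  have "x \<bullet> (diag_matrix d *v x) > 0" if "x \<noteq> 0" for x :: "real ^ 'n"
  proof -
    have "x \<bullet> (diag_matrix d *v x) = (\<Sum>i\<in>UNIV. d i * (x $ i)\<^sup>2)"
      by (simp add: inner_vec_def matrix_vector_mult_def diag_matrix_def mult_delta_left
          power2_eq_square mult.left_commute)
    moreover obtain k where "x $ k \<noteq> 0" using \<open>x \<noteq> 0\<close> by (auto simp: vec_eq_iff)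
    ultimately show ?thesis using d
      by (auto intro!: sum_pos2[of _ k] mult_nonneg_nonneg intro: less_imp_le)
  qed
  thus ?thesis by (simp add: pos_def_def transpose_diag_matrix)
qed

lemma orthogonal_matrix_invertible: "orthogonal_matrix R \<Longrightarrow> invertible R"
  by (auto simp: orthogonal_matrix_def invertible_def)

section \<open>Square roots, polar decomposition, and inequalities between trace and
  determinant\<close>

lemma pos_def_sqrt:
  fixes A :: "real ^ 'n ^ 'n"
  assumes "pos_def A"
  obtains G where "pos_def G" "G ** G = A"
proof -
  obtain R d where *: "orthogonal_matrix R" "A = transpose R ** diag_matrix d ** R" "\<And>i. d i > 0"
    by (rule pos_def_spectral[OF assms]) blast
  define G where "G = transpose R ** diag_matrix (\<lambda>i. sqrt (d i)) ** R"
  have "pos_def G"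
    unfolding G_def by (intro pos_def_congruence pos_def_diag_matrix orthogonal_matrix_invertible) (use * in auto)
  moreover have "G ** G = A"
    unfolding G_def orthogonal_matrix_conjugate(3)[OF *(1)] diag_matrix_mult *(2) real_sqrt_mult_self
    using *(3) by (simp add: abs_of_pos)
  ultimately show ?thesis using that by blast
qed

text \<open>Diagonalisation reduces this to \<open>ln t \<le> t - 1\<close> at each eigenvalue.
  Equality forces every eigenvalue to be 1, hence the identity matrix.\<close>

lemma ln_det_le_trace:
  fixes B :: "real ^ 'n ^ 'n"
  assumes "pos_def B"
  shows "ln (det B) \<le> trace B - CARD('n)"
    and "ln (det B) = trace B - CARD('n) \<Longrightarrow> B = mat 1"
proof -
  obtain R d where *: "orthogonal_matrix R" "B = transpose R ** diag_matrix d ** R" "\<And>i. d i > 0"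
    by (rule pos_def_spectral[OF assms]) blast
  have "det B = prod d UNIV" "trace B = sum d UNIV"
    unfolding *(2) orthogonal_matrix_conjugate(1,2)[OF *(1)]
    by (simp_all add: det_diag_matrix trace_diag_matrix)
  moreover have "d i \<noteq> 0" for i using *(3)[of i] by simp
  ultimately have ln: "ln (det B) = (\<Sum>i\<in>UNIV. ln (d i))"
    and tr: "trace B - CARD('n) = (\<Sum>i\<in>UNIV. d i - 1)"
    by (simp_all add: ln_prod sum_subtractf)
  have le: "ln (d i) \<le> d i - 1" for i using *(3) by (rule ln_le_minus_one)
  show "ln (det B) \<le> trace B - CARD('n)" unfolding ln tr by (intro sum_mono le)
  assume "ln (det B) = trace B - CARD('n)"
  hence "(\<Sum>i\<in>UNIV. (d i - 1) - ln (d i)) = 0" unfolding ln tr by (simp add: sum_subtractf)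
  hence "(d i - 1) - ln (d i) = 0" for i
    using le by (subst (asm) sum_nonneg_eq_0_iff) auto
  hence "d = (\<lambda>_. 1)" using ln_eq_minus_one[OF *(3)] by auto
  thus "B = mat 1" using * by (simp add: diag_matrix_1 orthogonal_matrix)
qed

text \<open>\<open>Q ** H\<close> need not be symmetric, but with \<open>G\<close> the square root
  of \<open>H\<close> the positive definite matrix \<open>G ** Q ** G\<close> has the same trace and
  determinant, so the eigenvalue inequality applies to it.\<close>

lemma trace_mult_ge:
  fixes Q H :: "real ^ 'n ^ 'n"
  assumes Q: "pos_def Q" and H: "pos_def H"
  shows "trace (Q ** H) \<ge> CARD('n) + ln (det Q * det H)"
    and "trace (Q ** H) = CARD('n) + ln (det Q * det H) \<Longrightarrow> Q ** H = mat 1"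
proof -
  obtain G where G: "pos_def G" "G ** G = H" by (rule pos_def_sqrt[OF H]) blast
  have B: "pos_def (G ** Q ** G)"
    using pos_def_congruence[OF Q pos_def_invertible[OF G(1)]] G(1) by (simp add: pos_def_def)
  have tr: "trace (Q ** H) = trace (G ** Q ** G)"
    using trace_mul_sym[of "Q ** G" G] by (simp add: G(2)[symmetric] matrix_mul_assoc)
  have det: "det Q * det H = det (G ** Q ** G)"
    by (simp add: G(2)[symmetric] det_mul)
  show "trace (Q ** H) \<ge> CARD('n) + ln (det Q * det H)"
    using ln_det_le_trace(1)[OF B] unfolding tr det by simp
  assume "trace (Q ** H) = CARD('n) + ln (det Q * det H)"
  hence "G ** Q ** G = mat 1" using ln_det_le_trace(2)[OF B] unfolding tr det by simp
  hence "G ** (Q ** G) = mat 1" by (simp add: matrix_mul_assoc)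
  hence "(Q ** G) ** G = mat 1" by (simp add: matrix_left_right_inverse)
  thus "Q ** H = mat 1" by (simp add: G(2)[symmetric] matrix_mul_assoc)
qed

text \<open>With \<open>H\<close> the positive square root of \<open>transpose N ** N\<close>, the
  orthogonal factor is \<open>H\<close> times the inverse of \<open>N\<close>.\<close>

lemma polar_decomposition:
  fixes N :: "real ^ 'n ^ 'n"
  assumes "invertible N"
  obtains R where "orthogonal_matrix R" "pos_def (R ** N)"
proof -
  have "pos_def (transpose N ** mat 1 ** N)"
    using pos_def_congruence[OF pos_def_diag_matrix[of "\<lambda>_. 1"] assms] by (simp add: diag_matrix_1)
  then obtain H where H: "pos_def H" "H ** H = transpose N ** N"
    using pos_def_sqrt by auto
  obtain M where M: "N ** M = mat 1" "M ** N = mat 1" using assms by (auto simp: invertible_def)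
  have "transpose (H ** M) ** (H ** M) = transpose M ** (H ** H) ** M"
    using H(1) by (simp add: pos_def_def matrix_transpose_mul matrix_mul_assoc)
  also have "\<dots> = transpose (N ** M) ** (N ** M)"
    unfolding H(2) by (simp add: matrix_transpose_mul matrix_mul_assoc)
  finally have "orthogonal_matrix (H ** M)" by (simp add: M orthogonal_matrix)
  moreover have "H ** M ** N = H" by (simp add: matrix_mul_assoc[symmetric] M)
  ultimately show ?thesis using that H(1) by metis
qed

lemma pos_def_inverse:
  fixes B :: "real ^ 'n ^ 'n"
  assumes "pos_def B"
  obtains H where "pos_def H" "B ** H = mat 1" "H ** B = mat 1"
proof -
  obtain H where H: "B ** H = mat 1" "H ** B = mat 1"
    using pos_def_invertible[OF assms] by (auto simp: invertible_def)
  hence "invertible H" by (auto simp: invertible_def)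
  from pos_def_congruence[OF assms this]
  have "pos_def (transpose H)" by (simp add: matrix_mul_assoc[symmetric] H)
  moreover from this have "transpose H = H" by (simp add: pos_def_def)
  ultimately show ?thesis using that H by metis
qed

lemma det_inverse_mult:
  assumes "A ** B = (mat 1 :: real ^ 'n ^ 'n)"
  shows "det A * det B = 1"
  by (metis assms det_I det_mul)

text \<open>Concavity of \<open>ln \<circ> det\<close>: its differential at \<open>Q1\<close> is \<open>D \<mapsto> trace (D ** H)\<close>.\<close>

lemma det_ge_imp_trace_inverse:
  fixes Q Q1 :: "real ^ 'n ^ 'n"
  assumes Q: "pos_def Q" and Q1: "pos_def Q1" and H: "Q1 ** H = mat 1" and le: "det Q1 \<le> det Q"
  shows "trace (Q ** H) \<ge> CARD('n)"
    and "trace (Q ** H) = CARD('n) \<Longrightarrow> Q = Q1"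
proof -
  have H': "pos_def H"
    using pos_def_inverse[OF Q1] H by (metis matrix_mul_assoc matrix_mul_lid matrix_mul_rid)
  have pos: "det Q1 > 0" "det H > 0" using Q1 H' by (auto intro: pos_def_det_pos)
  have "1 \<le> det Q * det H"
    using det_inverse_mult[OF H] mult_right_mono[OF le, of "det H"] pos by simp
  hence ge: "ln (det Q * det H) \<ge> 0" by simp
  show 1: "trace (Q ** H) \<ge> CARD('n)" using trace_mult_ge(1)[OF Q H'] ge by linarith
  assume "trace (Q ** H) = CARD('n)"
  hence "Q ** H = mat 1" using trace_mult_ge[OF Q H'] ge by linarith
  moreover have "H ** Q1 = mat 1" using H by (simp add: matrix_left_right_inverse)
  ultimately show "Q = Q1" by (metis matrix_mul_assoc matrix_mul_lid matrix_mul_rid)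
qed

lemma mult_transpose_self_eq_0:
  fixes Z :: "real ^ 'n ^ 'n"
  assumes "transpose Z ** Z = 0"
  shows "Z = 0"
proof -
  have "Z *v x = 0" for x
  proof -
    have "(Z *v x) \<bullet> (Z *v x) = x \<bullet> ((transpose Z ** Z) *v x)"
      by (simp add: matrix_vector_mul_assoc[symmetric] inner_vector_matrix_mult)
    thus ?thesis by (simp add: assms)
  qed
  thus ?thesis by (simp add: matrix_eq)
qed

lemma transpose_add: "transpose (A + B) = transpose A + transpose (B :: real ^ 'n ^ 'm)"
  by (simp add: transpose_def vec_eq_iff)

text \<open>Writing \<open>S = G ** G\<close> with \<open>G\<close> symmetric gives
  \<open>S + Y = G ** (mat 1 + Z) ** G\<close> with \<open>Z\<close> skew and nonzero. The square of
  \<open>det (mat 1 + Z)\<close> is the determinant of \<open>mat 1 + transpose Z ** Z\<close>,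
  whose eigenvalues are at least 1 and not all equal to 1. This is the source of strictness in the
  saddle argument.\<close>

lemma det_add_skew:
  fixes S Y :: "real ^ 'n ^ 'n"
  assumes S: "pos_def S" and Y: "transpose Y = - Y" "Y \<noteq> 0"
  shows "det S < \<bar>det (S + Y)\<bar>"
proof -
  obtain G where G: "pos_def G" "G ** G = S" by (rule pos_def_sqrt[OF S]) blast
  obtain H where H: "pos_def H" "G ** H = mat 1" "H ** G = mat 1" by (rule pos_def_inverse[OF G(1)]) blast
  have H': "H ** (G ** A) = A" "G ** (H ** A) = A" for A
    by (simp_all add: matrix_mul_assoc H)
  define Z where "Z = H ** Y ** H"
  have tH: "transpose H = H" using H(1) by (simp add: pos_def_def)
  have neg: "A ** (- B) = - (A ** B)" "(- A) ** B = - (A ** B)" for A B :: "real ^ 'n ^ 'n"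
    by (simp_all add: matrix_matrix_mult_def vec_eq_iff sum_negf)
  have tZ: "transpose Z = - Z"
    by (simp add: Z_def matrix_transpose_mul tH Y(1) matrix_mul_assoc neg)
  have GZG: "G ** Z ** G = Y"
    by (simp add: Z_def matrix_mul_assoc[symmetric] H H')
  have "Z \<noteq> 0" using GZG Y(2) by auto
  have SY: "S + Y = G ** (mat 1 + Z) ** G"
    by (simp add: matrix_add_ldistrib matrix_add_rdistrib G GZG)
  define E where "E = mat 1 + transpose Z ** Z"
  have E: "E = transpose (mat 1 + Z) ** (mat 1 + Z)"
    unfolding E_def transpose_add tZ
    by (simp add: neg matrix_add_ldistrib matrix_diff_rdistrib)
  have "transpose E = E" by (simp add: E matrix_transpose_mul)
  then obtain R d where R: "orthogonal_matrix R" "E = transpose R ** diag_matrix d ** R"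
    and d: "\<And>i. d i = R $ i \<bullet> (E *v R $ i)"
    by (rule spectral_theorem) blast
  have d1: "d i \<ge> 1" for i
  proof -
    have "d i = R $ i \<bullet> R $ i + (Z *v R $ i) \<bullet> (Z *v R $ i)"
      unfolding d E_def
      by (simp add: matrix_vector_mult_add_rdistrib inner_add_right matrix_vector_mul_assoc[symmetric]
          inner_vector_matrix_mult)
    thus ?thesis using R(1) by (simp add: orthogonal_matrix_rows)
  qed
  have "\<exists>i. d i > 1"
  proof (rule ccontr)
    assume "\<not> ?thesis"
    hence "d = (\<lambda>_. 1)" using d1 by (auto intro: antisym simp: not_less)
    hence "E = mat 1" using R by (simp add: diag_matrix_1 orthogonal_matrix)
    hence "transpose Z ** Z = 0" by (simp add: E_def)
    thus False using \<open>Z \<noteq> 0\<close> mult_transpose_self_eq_0 by blast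
  qed
  then obtain k where k: "d k > 1" by blast
  have "det E = prod d UNIV" by (simp only: R(2) orthogonal_matrix_conjugate(1)[OF R(1)] det_diag_matrix)
  also have "\<dots> = d k * prod d (UNIV - {k})" by (simp add: prod.remove)
  also have "\<dots> \<ge> d k * 1" using d1 k by (intro mult_left_mono prod_ge_1) auto
  finally have "det E > 1" using k by linarith
  hence "(det (mat 1 + Z))\<^sup>2 > 1" by (simp add: E det_mul power2_eq_square)
  hence "\<bar>det (mat 1 + Z)\<bar> > 1" by (metis abs_1 abs_le_square_iff not_le one_power2)
  moreover have "det (S + Y) = det S * det (mat 1 + Z)"
    unfolding SY by (simp add: G(2)[symmetric] det_mul)
  ultimately show ?thesis using pos_def_det_pos[OF S] by (simp add: abs_mult)
qed

text \<open>In the Leibniz expansion a permutation other than the identity moves at least two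
  indices. Differentiating one factor therefore still leaves a zero off-diagonal entry of the
  identity, and only the diagonal product contributes.\<close>

lemma det_has_derivative_at_mat_1:
  fixes A :: "real ^ 'n ^ 'n"
  shows "((\<lambda>t. det (mat 1 + t *\<^sub>R A)) has_real_derivative trace A) (at 0)"
proof -
  let ?I = "mat 1 :: real ^ 'n ^ 'n"
  define D where "D p = (\<Sum>i\<in>UNIV. A $ i $ p i * (\<Prod>j\<in>UNIV - {i}. ?I $ j $ p j))" for p
  have "((\<lambda>t. (?I + t *\<^sub>R A) $ i $ p i) has_real_derivative A $ i $ p i) (at 0)" for i p
    by (auto intro!: derivative_eq_intros)
  hence "((\<lambda>t. \<Prod>i\<in>UNIV. (?I + t *\<^sub>R A) $ i $ p i) has_real_derivative D p) (at 0)" for p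
    using has_field_derivative_prod[of UNIV "\<lambda>i t. (?I + t *\<^sub>R A) $ i $ p i" "\<lambda>i. A $ i $ p i" 0]
    by (simp add: D_def)
  hence "((\<lambda>t. det (?I + t *\<^sub>R A)) has_real_derivative
      (\<Sum>p | p permutes UNIV. of_int (sign p) * D p)) (at 0)"
    unfolding det_def by (intro DERIV_sum DERIV_cmult)
  also have "(\<Sum>p | p permutes UNIV. of_int (sign p) * D p) = (\<Sum>p\<in>{id}. of_int (sign p) * D p)"
  proof (rule sum.mono_neutral_right)
    show "\<forall>p\<in>{p. p permutes UNIV} - {id}. of_int (sign p) * D p = 0"
    proof
      fix p :: "'n \<Rightarrow> 'n" assume p: "p \<in> {p. p permutes UNIV} - {id}"
      hence "inj p" by (auto intro: permutes_inj)
      have "\<exists>j. j \<noteq> i \<and> j \<noteq> p j" for i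
        using p \<open>inj p\<close> by (metis Diff_iff eq_id_iff injD singletonI)
      hence "\<exists>j\<in>UNIV - {i}. ?I $ j $ p j = 0" for i
        by (simp add: mat_def) blast
      hence "(\<Prod>j\<in>UNIV - {i}. ?I $ j $ p j) = 0" for i
        by (intro prod_zero) auto
      hence "D p = 0" unfolding D_def by (simp only: mult_zero_right sum.neutral_const)
      thus "of_int (sign p) * D p = 0" by simp
    qed
  qed (auto simp: permutes_id finite_permutations)
  also have "\<dots> = trace A"
    by (simp add: D_def sign_id trace_def mat_def)
  finally show ?thesis .
qed

section \<open>Lebesgue measure of affine images\<close>

text \<open>The library computes the measure of a linear image only over index types in
  \<open>wellorder\<close>; this type is a well-ordered copy of an arbitrary finite index type.\<close>

typedef (overloaded) 'a index_copy = "{..<CARD('a::finite)}"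
  by (auto intro: exI[of _ 0])

instantiation index_copy :: (finite) linorder
begin
definition "a < b \<longleftrightarrow> Rep_index_copy a < Rep_index_copy b"
definition "a \<le> b \<longleftrightarrow> Rep_index_copy a \<le> Rep_index_copy b"
instance
  by intro_classes
    (auto simp: less_eq_index_copy_def less_index_copy_def Rep_index_copy_inject)
end

instance index_copy :: (finite) finite
proof
  have "inj (Rep_index_copy :: 'a index_copy \<Rightarrow> nat)"
    by (simp add: inj_def Rep_index_copy_inject)
  moreover have "range (Rep_index_copy :: 'a index_copy \<Rightarrow> nat) \<subseteq> {..<CARD('a)}"
    using Rep_index_copy by blast
  ultimately show "finite (UNIV :: 'a index_copy set)"
    by (meson finite_lessThan finite_subset finite_imageD)
qed

instance index_copy :: (finite) wellorder
proof -
  have "wf {(x :: 'a index_copy, y). x < y}"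
    by (auto simp add: trancl_def tranclp_less intro!: finite_acyclic_wf acyclicI)
  thus "OFCLASS('a index_copy, wellorder_class)"
    by (rule wf_wellorderI) intro_classes
qed

lemma bij_index_copy: "\<exists>\<pi> :: 'n::finite index_copy \<Rightarrow> 'n. bij \<pi>"
proof -
  have "CARD('n index_copy) = CARD('n)"
    using type_definition.card[OF type_definition_index_copy] by simp
  thus ?thesis using finite_same_card_bij[of "UNIV :: 'n index_copy set" "UNIV :: 'n set"] by auto
qed

section \<open>Transport of determinants and measures along a bijection of index types\<close>

lemma reindex_vector_mult:
  fixes A :: "real ^ 'n ^ 'n"
  assumes "bij (\<pi> :: 'm::finite \<Rightarrow> 'n::finite)"
  shows "(\<chi> i. (A *v x) $ \<pi> i) = (\<chi> i j. A $ \<pi> i $ \<pi> j) *v (\<chi> i. x $ \<pi> i)"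
  by (simp add: matrix_vector_mult_def vec_eq_iff sum.reindex_bij_betw[OF assms, symmetric])

lemma reindex_matrix_mult:
  fixes A B :: "real ^ 'n ^ 'n"
  assumes "bij (\<pi> :: 'm::finite \<Rightarrow> 'n::finite)"
  shows "(\<chi> i j. (A ** B) $ \<pi> i $ \<pi> j) = (\<chi> i j. A $ \<pi> i $ \<pi> j) ** (\<chi> i j. B $ \<pi> i $ \<pi> j)"
  by (simp add: matrix_matrix_mult_def vec_eq_iff sum.reindex_bij_betw[OF assms, symmetric])

text \<open>Diagonalisation commutes with relabelling the indices, so both determinants are the
  product of the same eigenvalues. This avoids comparing signs of permutations of two different
  types.\<close>

lemma det_reindex_pos_def:
  fixes A :: "real ^ 'n ^ 'n"
  assumes \<pi>: "bij (\<pi> :: 'm::finite \<Rightarrow> 'n::finite)" and "pos_def A"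
  shows "det (\<chi> i j. A $ \<pi> i $ \<pi> j) = det A"
proof -
  obtain R d where R: "orthogonal_matrix R" and A: "A = transpose R ** diag_matrix d ** R"
    by (rule pos_def_spectral[OF \<open>pos_def A\<close>]) blast
  define R' :: "real ^ 'm ^ 'm" where "R' = (\<chi> i j. R $ \<pi> i $ \<pi> j)"
  have t: "(\<chi> i j. transpose R $ \<pi> i $ \<pi> j) = transpose R'"
    by (simp add: transpose_def R'_def)
  have "inj \<pi>" using \<pi> by (rule bij_is_inj)
  hence "transpose R' ** R' = (\<chi> i j. (transpose R ** R) $ \<pi> i $ \<pi> j)"
    by (simp add: reindex_matrix_mult[OF \<pi>] t) (simp add: R'_def)
  also have "\<dots> = mat 1"
    using R \<open>inj \<pi>\<close> by (simp add: orthogonal_matrix mat_def vec_eq_iff inj_eq)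
  finally have R': "orthogonal_matrix R'" by (simp add: orthogonal_matrix)
  have "(\<chi> i j. diag_matrix d $ \<pi> i $ \<pi> j) = diag_matrix (d \<circ> \<pi>)"
    using \<open>inj \<pi>\<close> by (simp add: diag_matrix_def vec_eq_iff inj_eq)
  hence "(\<chi> i j. A $ \<pi> i $ \<pi> j) = transpose R' ** diag_matrix (d \<circ> \<pi>) ** R'"
    unfolding A by (simp add: reindex_matrix_mult[OF \<pi>] t) (simp add: R'_def)
  hence "det (\<chi> i j. A $ \<pi> i $ \<pi> j) = prod (d \<circ> \<pi>) UNIV"
    by (simp only: orthogonal_matrix_conjugate(1)[OF R'] det_diag_matrix)
  also have "\<dots> = prod d UNIV"
    using prod.reindex_bij_betw[OF \<pi>, of d] by simp
  also have "\<dots> = det A" by (simp only: A orthogonal_matrix_conjugate(1)[OF R] det_diag_matrix)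
  finally show ?thesis .
qed

lemma prod_Basis_cart: "prod f Basis = (\<Prod>i\<in>UNIV. f (axis i 1 :: real ^ 'n))"
proof -
  have "(Basis :: (real ^ 'n) set) = range (\<lambda>i. axis i 1)" by (auto simp: Basis_vec_def)
  moreover have "inj (\<lambda>i. axis i 1 :: real ^ 'n)" by (auto simp: inj_def axis_eq_axis)
  ultimately show ?thesis using prod.reindex[of "\<lambda>i. axis i 1 :: real ^ 'n" UNIV f] by simp
qed

text \<open>Lebesgue measure is characterised by its values on boxes, and relabelling coordinates
  only permutes the side lengths of a box.\<close>

lemma lborel_reindex:
  assumes \<pi>: "bij (\<pi> :: 'm::finite \<Rightarrow> 'n::finite)"
  shows "lborel = distr (lborel :: (real ^ 'n) measure) borel (\<lambda>x. \<chi> i. x $ \<pi> i)"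
proof (rule lborel_eqI)
  let ?T = "\<lambda>x :: real ^ 'n. \<chi> i. x $ \<pi> i"
  define S :: "real ^ 'm \<Rightarrow> real ^ 'n" where "S y = (\<chi> k. y $ inv \<pi> k)" for y
  have [measurable]: "?T \<in> borel \<rightarrow>\<^sub>M borel"
    by (intro borel_measurable_continuous_onI continuous_intros)
  have inv: "inv \<pi> (\<pi> i) = i" "\<pi> (inv \<pi> k) = k" for i k
    using \<pi> by (simp_all add: bij_is_inj bij_is_surj surj_f_inv_f)
  fix l u :: "real ^ 'm" assume le: "\<And>b. b \<in> Basis \<Longrightarrow> l \<bullet> b \<le> u \<bullet> b"
  have lu: "l $ i \<le> u $ i" for i
    using le[of "axis i 1"] by (simp add: inner_axis)
  have "?T -` box l u = box (S l) (S u)"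
    by (auto simp: mem_box_cart S_def) (metis inv(1) inv(2))+
  hence "emeasure (distr lborel borel ?T) (box l u) = emeasure lborel (box (S l) (S u))"
    by (subst emeasure_distr) auto
  also have "\<dots> = ennreal (\<Prod>b\<in>Basis. (S u - S l) \<bullet> b)"
    using lu by (intro emeasure_lborel_box) (auto simp: Basis_vec_def inner_axis S_def)
  also have "(\<Prod>b\<in>Basis. (S u - S l) \<bullet> b) = (\<Prod>k\<in>UNIV. u $ inv \<pi> k - l $ inv \<pi> k)"
    unfolding prod_Basis_cart by (simp add: inner_axis S_def)
  also have "\<dots> = (\<Prod>i\<in>UNIV. u $ i - l $ i)"
    by (subst prod.reindex_bij_betw[OF \<pi>, symmetric]) (simp add: inv)
  also have "\<dots> = (\<Prod>b\<in>Basis. (u - l) \<bullet> b)"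
    unfolding prod_Basis_cart by (simp add: inner_axis)
  finally show "emeasure (distr lborel borel ?T) (box l u) = ennreal (\<Prod>b\<in>Basis. (u - l) \<bullet> b)" .
qed simp

lemma measure_reindex:
  assumes \<pi>: "bij (\<pi> :: 'm::finite \<Rightarrow> 'n::finite)" and M: "compact (M :: (real ^ 'n) set)"
  shows "compact ((\<lambda>x. \<chi> i. x $ \<pi> i) ` M)"
    "measure lebesgue ((\<lambda>x. \<chi> i. x $ \<pi> i) ` M) = measure lebesgue M"
proof -
  let ?T = "\<lambda>x :: real ^ 'n. \<chi> i. x $ \<pi> i"
  show comp: "compact (?T ` M)"
    by (intro compact_continuous_image continuous_intros M)
  have [measurable]: "?T \<in> borel \<rightarrow>\<^sub>M borel"
    by (intro borel_measurable_continuous_onI continuous_intros)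
  have "inj ?T"
    using \<pi> by (auto simp: inj_def vec_eq_iff) (metis bij_pointE)
  hence vim: "?T -` ?T ` M = M" by (simp add: inj_vimage_image_eq)
  have "measure lebesgue (?T ` M) = measure lborel (?T ` M)"
    using comp by (simp add: measure_completion borel_compact)
  also have "\<dots> = measure (distr lborel borel ?T) (?T ` M)"
    by (simp only: lborel_reindex[OF \<pi>, symmetric])
  also have "\<dots> = measure lborel M"
    using comp by (subst measure_distr) (auto simp: vim borel_compact)
  also have "\<dots> = measure lebesgue M"
    using M by (simp add: measure_completion borel_compact)
  finally show "measure lebesgue (?T ` M) = measure lebesgue M" .
qed

lemma measure_affine_image:
  fixes M :: "(real ^ 'n) set"
  assumes Q: "pos_def Q" and M: "compact M"
  shows "measure lebesgue (affine_image Q w M) = det Q * measure lebesgue M"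
proof -
  obtain \<pi> :: "'n index_copy \<Rightarrow> 'n" where \<pi>: "bij \<pi>" using bij_index_copy by blast
  let ?T = "\<lambda>x :: real ^ 'n. \<chi> i. x $ \<pi> i"
  define Q' where "Q' = (\<chi> i j. Q $ \<pi> i $ \<pi> j)"
  have comp: "compact ((*v) Q ` M)"
    by (intro compact_continuous_image continuous_intros M)
  have "affine_image Q w M = (+) w ` (*v) Q ` M"
    by (auto simp: affine_image_def add.commute image_image)
  hence "measure lebesgue (affine_image Q w M) = measure lebesgue ((*v) Q ` M)"
    by (simp add: measure_translation)
  also have "\<dots> = measure lebesgue (?T ` (*v) Q ` M)"
    using measure_reindex(2)[OF \<pi> comp] by simp
  also have "?T ` (*v) Q ` M = (*v) Q' ` ?T ` M"
    by (simp add: image_image reindex_vector_mult[OF \<pi>] Q'_def)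
  also have "measure lebesgue \<dots> = \<bar>det Q'\<bar> * measure lebesgue (?T ` M)"
    by (subst measure_linear_image) (auto intro: lmeasurable_compact measure_reindex[OF \<pi> M])
  also have "\<dots> = det Q * measure lebesgue M"
    using pos_def_det_pos[OF Q] unfolding Q'_def det_reindex_pos_def[OF \<pi> Q] measure_reindex(2)[OF \<pi> M]
    by simp
  finally show ?thesis .
qed

lemma measure_convex_body_pos:
  assumes "convex_body M"
  shows "measure lebesgue M > 0"
proof -
  obtain x r where "r > 0" "ball x r \<subseteq> M"
    using assms unfolding convex_body_def by (metis ex_in_conv mem_interior)
  hence "measure lebesgue (ball x r) \<le> measure lebesgue M"
    using assms by (intro measure_mono_fmeasurable) (auto simp: convex_body_def lmeasurable_compact)
  moreover have "measure lebesgue (ball x r) > 0" using content_ball_pos[OF \<open>r > 0\<close>, of x] by simp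
  ultimately show ?thesis by linarith
qed

section \<open>Positive John images\<close>

text \<open>Since every positive image of \<open>M\<close> has volume \<open>det Q\<close> times
  that of \<open>M\<close>, maximal volume is recorded as maximal determinant. Later arguments about
  John images are then free of measure theory.\<close>

definition max_position ::
  "(real ^ 'n) set \<Rightarrow> (real ^ 'n) set \<Rightarrow> real ^ 'n ^ 'n \<Rightarrow> real ^ 'n \<Rightarrow> bool" where
  "max_position K M Q w \<longleftrightarrow> pos_def Q \<and> affine_image Q w M \<subseteq> K \<and>
     (\<forall>Q' w'. pos_def Q' \<longrightarrow> affine_image Q' w' M \<subseteq> K \<longrightarrow> det Q' \<le> det Q)"

lemma max_position_iff_positive_John_image:
  assumes "convex_body M" "pos_def Q"
  shows "positive_John_image K M (affine_image Q w M) \<longleftrightarrow> max_position K M Q w"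
proof -
  have "compact M" using assms(1) by (simp add: convex_body_def)
  hence "measure lebesgue (affine_image Q' w' M) \<le> measure lebesgue (affine_image Q w M)
      \<longleftrightarrow> det Q' \<le> det Q" if "pos_def Q'" for Q' w'
    using measure_affine_image that assms measure_convex_body_pos by (metis mult_le_cancel_right_pos)
  with assms(2) show ?thesis
    unfolding positive_John_image_def positive_image_def max_position_def by metis
qed

section \<open>Rank-one perturbations and uniqueness of the maximal position\<close>

lemma inner_outer_product:
  fixes d :: "real ^ 'n"
  shows "(\<chi> i j. d $ i * d $ j) *v x = (d \<bullet> x) *\<^sub>R d"
    "trace ((\<chi> i j. d $ i * d $ j) ** H) = d \<bullet> (H *v d)"
proof -
  show "(\<chi> i j. d $ i * d $ j) *v x = (d \<bullet> x) *\<^sub>R d"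
    by (simp add: matrix_vector_mult_def vec_eq_iff inner_vec_def sum_distrib_left sum_distrib_right mult_ac)
  have "trace ((\<chi> i j. d $ i * d $ j) ** H) = (\<Sum>i\<in>UNIV. \<Sum>k\<in>UNIV. d $ i * d $ k * H $ k $ i)"
    by (simp add: trace_def matrix_matrix_mult_def)
  also have "\<dots> = (\<Sum>k\<in>UNIV. \<Sum>i\<in>UNIV. d $ i * d $ k * H $ k $ i)" by (rule sum.swap)
  also have "\<dots> = d \<bullet> (H *v d)"
    by (simp add: inner_vec_def matrix_vector_mult_def sum_distrib_left mult_ac)
  finally show "trace ((\<chi> i j. d $ i * d $ j) ** H) = d \<bullet> (H *v d)" .
qed

lemma pos_def_add:
  assumes "pos_def A" "pos_def B"
  shows "pos_def (A + B)"
  using assms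
  by (simp add: pos_def_def transpose_add matrix_vector_mult_add_rdistrib inner_add_right add_pos_pos)

lemma pos_def_scaleR:
  assumes "pos_def A" "c > 0"
  shows "pos_def (c *\<^sub>R A)"
  using assms by (simp add: pos_def_def transpose_scalar scaleR_matrix_vector_assoc[symmetric])

lemma trace_scaleR: "trace (c *\<^sub>R A) = c * trace (A :: real ^ 'n ^ 'n)"
  by (simp add: trace_def sum_distrib_left)

text \<open>By convexity of \<open>K\<close> the average \<open>B\<close> of the two maximisers is
  admissible, so its determinant is not larger than theirs. The traces of \<open>Q ** H\<close> and
  \<open>Q' ** H\<close>, with \<open>H\<close> the inverse of \<open>B\<close>, are then each at
  least the dimension but sum to exactly twice it. The equality case gives
  \<open>Q = B = Q'\<close>.\<close>

lemma max_position_matrix_unique: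
  fixes Q Q' :: "real ^ 'n ^ 'n"
  assumes K: "convex K" and m: "max_position K M Q w" "max_position K M Q' w'"
  shows "Q = Q'"
proof -
  have Q: "pos_def Q" "pos_def Q'" and sub: "affine_image Q w M \<subseteq> K" "affine_image Q' w' M \<subseteq> K"
    using m by (auto simp: max_position_def)
  have det: "det Q' = det Q"
    using m unfolding max_position_def by (metis order_antisym)
  define B where "B = (1/2) *\<^sub>R (Q + Q')"
  have B: "pos_def B" using Q by (simp add: B_def pos_def_add pos_def_scaleR)
  have "affine_image B ((1/2) *\<^sub>R (w + w')) M \<subseteq> K"
  proof
    fix y assume "y \<in> affine_image B ((1/2) *\<^sub>R (w + w')) M"
    then obtain x where x: "x \<in> M" and "y = B *v x + (1/2) *\<^sub>R (w + w')"
      by (auto simp: affine_image_def)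
    hence "y = (1/2) *\<^sub>R (Q *v x + w) + (1/2) *\<^sub>R (Q' *v x + w')"
      by (simp add: B_def scaleR_matrix_vector_assoc[symmetric] matrix_vector_mult_add_rdistrib scaleR_add_right)
    moreover have "Q *v x + w \<in> K" "Q' *v x + w' \<in> K"
      using x sub by (auto simp: affine_image_def)
    ultimately show "y \<in> K" using convexD[OF K, of _ _ "1/2" "1/2"] by simp
  qed
  hence le: "det B \<le> det Q" using m(1) B unfolding max_position_def by blast
  obtain H where H: "B ** H = mat 1" by (rule pos_def_inverse[OF B]) blast
  have "trace (Q ** H) + trace (Q' ** H) = trace ((2 *\<^sub>R B) ** H)"
    by (simp add: B_def matrix_add_rdistrib trace_add)
  also have "\<dots> = 2 * real CARD('n)"
    by (simp add: scalar_matrix_assoc[symmetric] H trace_scaleR trace_I)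
  finally have "trace (Q ** H) = CARD('n)" "trace (Q' ** H) = CARD('n)"
    using det_ge_imp_trace_inverse(1)[OF Q(1) B H le] det_ge_imp_trace_inverse(1)[OF Q(2) B H] le det
    by linarith+
  thus ?thesis
    using det_ge_imp_trace_inverse(2)[OF Q(1) B H le] det_ge_imp_trace_inverse(2)[OF Q(2) B H] le det by simp
qed

text \<open>If two translates \<open>Q M + w\<close> and \<open>Q M + w'\<close> lie in \<open>K\<close>, then \<open>Q\<close> can be enlarged by a
  rank one matrix in the direction \<open>w' - w\<close>.\<close>

lemma max_position_translation_unique:
  fixes Q :: "real ^ 'n ^ 'n"
  assumes K: "convex K" and M: "bounded M" and m: "max_position K M Q w" "max_position K M Q w'"
  shows "w = w'"
proof (rule ccontr)
  assume "w \<noteq> w'"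
  define d where "d = w' - w"
  have d: "d \<noteq> 0" using \<open>w \<noteq> w'\<close> by (simp add: d_def)
  obtain b where b: "b > 0" "\<And>x. x \<in> M \<Longrightarrow> norm x \<le> b" using M by (auto simp: bounded_pos)
  \<comment> \<open>This size makes the shift \<open>s\<close> below at most 1/2 in absolute value
    on all of \<open>M\<close>, so that \<open>1/2 - s\<close> and \<open>1/2 + s\<close> are convex
    weights for the two translates.\<close>
  define \<epsilon> where "\<epsilon> = 1 / (2 * (norm d * b))"
  have \<epsilon>: "\<epsilon> > 0" using b d by (simp add: \<epsilon>_def)
  define D :: "real ^ 'n ^ 'n" where "D = (\<chi> i j. d $ i * d $ j)"
  have Q: "pos_def Q" and sub: "affine_image Q w M \<subseteq> K" "affine_image Q w' M \<subseteq> K"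
    using m by (auto simp: max_position_def)
  define Q1 where "Q1 = Q + \<epsilon> *\<^sub>R D"
  have tD: "transpose D = D" by (simp add: D_def transpose_def vec_eq_iff mult.commute)
  have Q1: "pos_def Q1"
    unfolding pos_def_def
  proof (intro conjI allI impI)
    show "transpose Q1 = Q1" using Q by (simp add: Q1_def transpose_add transpose_scalar tD pos_def_def)
    fix x :: "real ^ 'n" assume "x \<noteq> 0"
    have "x \<bullet> (Q1 *v x) = x \<bullet> (Q *v x) + \<epsilon> * (d \<bullet> x)\<^sup>2"
      by (simp add: Q1_def D_def matrix_vector_mult_add_rdistrib inner_add_right
          scaleR_matrix_vector_assoc[symmetric] inner_outer_product power2_eq_square inner_commute)
    moreover have "x \<bullet> (Q *v x) > 0" using Q \<open>x \<noteq> 0\<close> by (simp add: pos_def_def)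
    moreover have "\<epsilon> * (d \<bullet> x)\<^sup>2 \<ge> 0" using \<epsilon> by simp
    ultimately show "x \<bullet> (Q1 *v x) > 0" by linarith
  qed
  have "affine_image Q1 ((1/2) *\<^sub>R (w + w')) M \<subseteq> K"
  proof
    fix y assume "y \<in> affine_image Q1 ((1/2) *\<^sub>R (w + w')) M"
    then obtain x where x: "x \<in> M" and y: "y = Q1 *v x + (1/2) *\<^sub>R (w + w')"
      by (auto simp: affine_image_def)
    define s where "s = \<epsilon> * (d \<bullet> x)"
    have "\<bar>d \<bullet> x\<bar> \<le> norm d * b"
      using Cauchy_Schwarz_ineq2[of d x] b(2)[OF x] by (meson mult_left_mono norm_ge_zero order_trans)
    hence "\<bar>s\<bar> \<le> \<epsilon> * (norm d * b)"
      using \<epsilon> by (simp add: s_def abs_mult)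
    also have "\<dots> = 1/2" using d b by (simp add: \<epsilon>_def)
    finally have s: "0 \<le> 1/2 - s" "0 \<le> 1/2 + s" by linarith+
    have "y = (1/2 - s) *\<^sub>R (Q *v x + w) + (1/2 + s) *\<^sub>R (Q *v x + w')"
    proof -
      have "Q1 *v x = Q *v x + s *\<^sub>R d"
        by (simp add: Q1_def D_def matrix_vector_mult_add_rdistrib scaleR_matrix_vector_assoc[symmetric]
            inner_outer_product s_def)
      thus ?thesis unfolding y d_def by (simp add: vec_eq_iff algebra_simps)
    qed
    moreover have "Q *v x + w \<in> K" "Q *v x + w' \<in> K"
      using x sub by (auto simp: affine_image_def)
    ultimately show "y \<in> K" using convexD[OF K _ _ s] by simp
  qed
  hence le: "det Q1 \<le> det Q" using m(1) Q1 unfolding max_position_def by blast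
  obtain H where H: "pos_def H" "Q1 ** H = mat 1" by (rule pos_def_inverse[OF Q1]) blast
  \<comment> \<open>The left side equals the dimension and the rank-one term is strictly positive,
    so \<open>trace (Q ** H)\<close> is less than the dimension. This contradicts
    \<open>det Q1 \<le> det Q\<close>.\<close>
  have "trace (Q1 ** H) = trace (Q ** H) + \<epsilon> * (d \<bullet> (H *v d))"
    by (simp add: Q1_def D_def matrix_add_rdistrib trace_add scalar_matrix_assoc[symmetric]
        trace_scaleR inner_outer_product)
  moreover have "\<epsilon> * (d \<bullet> (H *v d)) > 0" using H(1) d \<epsilon> by (simp add: pos_def_def)
  ultimately show False
    using det_ge_imp_trace_inverse(1)[OF Q Q1 H(2) le] by (simp add: H(2) trace_I)
qed

section \<open>Existence of a position of maximal determinant\<close>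

lemma pos_semidef_det_pos_imp_pos_def:
  fixes Q :: "real ^ 'n ^ 'n"
  assumes "transpose Q = Q" "\<And>x. x \<bullet> (Q *v x) \<ge> 0" "det Q > 0"
  shows "pos_def Q"
proof -
  obtain R d where R: "orthogonal_matrix R" "Q = transpose R ** diag_matrix d ** R"
    and d: "\<And>i. d i = R $ i \<bullet> (Q *v R $ i)"
    using spectral_theorem[OF assms(1)] by blast
  have "prod d UNIV \<noteq> 0"
    using assms(3) by (simp only: R(2) orthogonal_matrix_conjugate(1)[OF R(1)] det_diag_matrix)
  hence "d i > 0" for i using assms(2)[of "R $ i"] by (auto simp: d[symmetric] less_le prod_zero_iff)
  thus ?thesis
    using R by (simp add: pos_def_congruence pos_def_diag_matrix orthogonal_matrix_invertible)
qed

text \<open>A ball of radius \<open>r\<close> inside \<open>M\<close> controls \<open>Q\<close>: for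
  a unit vector \<open>v\<close>, the vector \<open>r *\<^sub>R (Q *v v)\<close> is a difference of
  two points of the bounded set \<open>K\<close>. The bound on \<open>w\<close> follows by
  evaluating at the centre of the ball.\<close>

lemma bounded_positive_images:
  fixes K M :: "(real ^ 'n) set"
  assumes K: "bounded K" and M: "interior M \<noteq> {}"
  shows "bounded {(Q, w). transpose Q = Q \<and> affine_image Q w M \<subseteq> K}"
proof -
  obtain c where c: "c > 0" "\<And>y. y \<in> K \<Longrightarrow> norm y \<le> c" using K by (auto simp: bounded_pos)
  obtain m r where r: "r > 0" "cball m r \<subseteq> M"
    using M by (metis ex_in_conv mem_interior_cball)
  show ?thesis
  proof (rule boundedI)
    fix p :: "(real ^ 'n ^ 'n) \<times> (real ^ 'n)" assume "p \<in> {(Q, w). transpose Q = Q \<and> affine_image Q w M \<subseteq> K}"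
    then obtain Q w where p: "p = (Q, w)" and Q: "transpose Q = Q" and sub: "affine_image Q w M \<subseteq> K"
      by auto
    have inK: "norm (Q *v x + w) \<le> c" if "x \<in> cball m r" for x
    proof -
      have "x \<in> M" using that r by blast
      thus ?thesis using sub c(2) by (auto simp: affine_image_def)
    qed
    have unit: "norm (Q *v v) \<le> 2 * c / r" if v: "norm v = 1" for v
    proof -
      have "r *\<^sub>R (Q *v v) = (Q *v (m + r *\<^sub>R v) + w) - (Q *v m + w)"
        by (simp add: matrix_vector_right_distrib matrix_vector_mult_scaleR)
      hence "norm (r *\<^sub>R (Q *v v)) \<le> norm (Q *v (m + r *\<^sub>R v) + w) + norm (Q *v m + w)"
        by (metis norm_triangle_ineq4)
      also have "\<dots> \<le> c + c"
        using r v by (intro add_mono inK) (auto simp: dist_norm)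
      finally show ?thesis using r by (simp add: field_simps)
    qed
    have row: "norm (Q $ i) \<le> 2 * c / r" for i
    proof -
      \<comment> \<open>Symmetry turns the row into a column, which is the image of a unit
        vector.\<close>
      have "Q $ i = column i (transpose Q)" by (simp add: column_def transpose_def vec_eq_iff)
      also have "\<dots> = Q *v axis i 1" unfolding Q by (simp add: matrix_vector_mult_basis)
      finally show ?thesis using unit[of "axis i 1"] by simp
    qed
    have "norm Q \<le> (\<Sum>i\<in>UNIV. norm (Q $ i))"
      unfolding norm_vec_def by (rule L2_set_le_sum) simp
    also have "\<dots> \<le> (\<Sum>i\<in>(UNIV :: 'n set). 2 * c / r)" by (intro sum_mono row)
    finally have nQ: "norm Q \<le> real CARD('n) * (2 * c / r)" by simp
    have "norm (Q *v m) \<le> norm m * (2 * c / r)"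
    proof (cases "m = 0")
      case False
      have "Q *v m = norm m *\<^sub>R (Q *v (m /\<^sub>R norm m))"
        using False by (simp add: matrix_vector_mult_scaleR)
      hence "norm (Q *v m) = norm m * norm (Q *v (m /\<^sub>R norm m))"
        by (metis abs_norm_cancel norm_scaleR)
      moreover have "norm (Q *v (m /\<^sub>R norm m)) \<le> 2 * c / r" using False by (intro unit) simp
      ultimately show ?thesis by (metis mult_left_mono norm_ge_zero)
    qed simp
    moreover have "norm w \<le> norm (Q *v m + w) + norm (Q *v m)"
      by (metis add_diff_cancel_left' norm_triangle_ineq4)
    moreover have "norm (Q *v m + w) \<le> c" using r by (intro inK) simp
    ultimately have "norm w \<le> c + norm m * (2 * c / r)" by linarith
    with nQ show "norm p \<le> real CARD('n) * (2 * c / r) + (c + norm m * (2 * c / r))"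
      unfolding p using norm_Pair_le[of Q w] by linarith
  qed
qed

text \<open>Positive definiteness is not a closed condition, so the determinant is maximised over
  the compact set of positive semidefinite positions. A small homothetic copy of \<open>M\<close> in
  a ball inside \<open>K\<close> shows that the maximum is positive, which makes the maximiser
  positive definite.\<close>

lemma max_position_exists:
  fixes K M :: "(real ^ 'n) set"
  assumes K: "convex_body K" and M: "convex_body M"
  obtains Q w where "max_position K M Q w"
proof -
  define F where "F = {(Q :: real ^ 'n ^ 'n, w). (transpose Q = Q \<and> affine_image Q w M \<subseteq> K) \<and> (\<forall>x. x \<bullet> (Q *v x) \<ge> 0)}"
  have F_memI: "(Q, w) \<in> F" if "pos_def Q" "affine_image Q w M \<subseteq> K" for Q w
  proof -
    have "x \<bullet> (Q *v x) \<ge> 0" for x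
      using that(1) by (cases "x = 0") (auto simp: pos_def_def less_imp_le)
    with that show ?thesis by (auto simp: F_def pos_def_def)
  qed
  have "bounded F"
    using K M by (intro bounded_subset[OF bounded_positive_images[of K M]])
      (auto simp: F_def convex_body_def compact_imp_bounded)
  moreover have "closed F"
  proof -
    have "F = {p. \<forall>i j. fst p $ i $ j = fst p $ j $ i}
        \<inter> (\<Inter>x\<in>M. (\<lambda>p. fst p *v x + snd p) -` K)
        \<inter> {p. \<forall>x. 0 \<le> x \<bullet> (fst p *v x)}"
      by (auto simp: F_def affine_image_def transpose_def vec_eq_iff)
    moreover have "closed K" using K by (simp add: convex_body_def compact_imp_closed)
    ultimately show ?thesis
      unfolding matrix_mult_dot
      by (auto intro!: closed_Int closed_INT closed_Collect_all closed_Collect_eq closed_Collect_le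
          continuous_closed_vimage continuous_intros)
  qed
  ultimately have "compact F" by (simp add: compact_eq_bounded_closed)
  moreover have "continuous_on F (\<lambda>p. det (fst p))"
    unfolding det_def by (intro continuous_intros)
  moreover obtain Q0 w0 where Q0: "pos_def Q0" "affine_image Q0 w0 M \<subseteq> K"
  proof -
    obtain k s where s: "s > 0" "cball k s \<subseteq> K"
      using K unfolding convex_body_def by (metis ex_in_conv mem_interior_cball)
    have "bounded M" using M by (simp add: convex_body_def compact_imp_bounded)
    then obtain b where b: "b > 0" "\<And>x. x \<in> M \<Longrightarrow> norm x \<le> b" by (auto simp: bounded_pos)
    have I: "pos_def (mat 1 :: real ^ 'n ^ 'n)"
      using pos_def_diag_matrix[of "\<lambda>_. 1"] by (simp add: diag_matrix_1)
    have "affine_image ((s / b) *\<^sub>R mat 1) k M \<subseteq> cball k s"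
    proof
      fix y assume "y \<in> affine_image ((s / b) *\<^sub>R mat 1) k M"
      then obtain x where x: "x \<in> M" "y = (s / b) *\<^sub>R x + k"
        by (auto simp: affine_image_def scaleR_matrix_vector_assoc[symmetric])
      have "s / b * norm x \<le> s / b * b" using b s x by (intro mult_left_mono) auto
      thus "y \<in> cball k s" using x b s by (simp add: dist_norm)
    qed
    with s have "affine_image ((s / b) *\<^sub>R mat 1) k M \<subseteq> K" by blast
    moreover have "pos_def ((s / b) *\<^sub>R mat 1 :: real ^ 'n ^ 'n)"
      using I s b by (intro pos_def_scaleR) auto
    ultimately show ?thesis using that by blast
  qed
  ultimately obtain Q w where Qw: "(Q, w) \<in> F" and max: "\<And>Q' w'. (Q', w') \<in> F \<Longrightarrow> det Q' \<le> det Q"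
    using continuous_attains_sup[of F "\<lambda>p. det (fst p)"] F_memI by force
  have "det Q > 0" using max[OF F_memI[OF Q0]] pos_def_det_pos[OF Q0(1)] by linarith
  hence "pos_def Q"
    using Qw by (intro pos_semidef_det_pos_imp_pos_def) (auto simp: F_def)
  hence "max_position K M Q w"
    using Qw max F_memI unfolding max_position_def by (auto simp: F_def)
  thus ?thesis by (rule that)
qed

lemma convex_body_orthogonal_image:
  fixes L :: "(real ^ 'n) set"
  assumes V: "orthogonal_matrix V" and L: "convex_body L"
  shows "convex_body ((*v) V ` L)"
proof -
  have "inj ((*v) V)"
    using orthogonal_matrix_invertible[OF V] by (metis invertible_left_inverse matrix_left_invertible_injective)
  hence "interior ((*v) V ` L) = (*v) V ` interior L"
    by (intro interior_injective_linear_image) auto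
  thus ?thesis
    using L unfolding convex_body_def
    by (auto intro!: compact_continuous_image continuous_intros convex_linear_image)
qed

text \<open>Existence and uniqueness of the maximal position resolve the definite description in
  \<open>John_pair\<close>. The main proof uses John pairs only through this fact.\<close>

lemma John_pair_eq:
  fixes K L :: "(real ^ 'n) set"
  assumes K: "convex_body K" and L: "convex_body L" and V: "orthogonal_matrix V"
  shows "max_position K ((*v) V ` L) (P_star K L V) (z_star K L V)"
proof -
  let ?M = "(*v) V ` L"
  have M: "convex_body ?M" by (rule convex_body_orthogonal_image[OF V L])
  obtain Q w where Qw: "max_position K ?M Q w" by (rule max_position_exists[OF K M])
  have unique: "(Q', w') = (Q, w)" if "max_position K ?M Q' w'" for Q' w'
  proof -
    have "Q' = Q" using K Qw that by (intro max_position_matrix_unique) (auto simp: convex_body_def)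
    with Qw that K M show ?thesis
      by (auto intro!: max_position_translation_unique[of K ?M] simp: convex_body_def compact_imp_bounded)
  qed
  have "(pos_def Q' \<and> positive_John_image K ?M (affine_image Q' w' ?M)) \<longleftrightarrow> max_position K ?M Q' w'" for Q' w'
    using max_position_iff_positive_John_image[OF M, of Q' K w'] unfolding max_position_def by blast
  hence "John_pair K L V = (THE (Q', w'). max_position K ?M Q' w')"
    unfolding John_pair_def by (simp only:)
  also have "\<dots> = (Q, w)"
  proof (rule the_equality)
    show "case (Q, w) of (Q', w') \<Rightarrow> max_position K ?M Q' w'" using Qw by simp
    show "p = (Q, w)" if "case p of (Q', w') \<Rightarrow> max_position K ?M Q' w'" for p
      using that unique by (cases p) (simp only: prod.case)
  qed
  finally have "John_pair K L V = (Q, w)" .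
  thus ?thesis using Qw by (simp add: P_star_def z_star_def)
qed

section \<open>Contact pairs and the John decomposition\<close>

text \<open>Factoring \<open>P + t *\<^sub>R S\<close> as
  \<open>(mat 1 + t *\<^sub>R (S ** H)) ** P\<close> reduces the growth of the determinant to the
  derivative at the identity, which is \<open>trace (S ** H)\<close>. Positive definiteness survives
  for small \<open>t\<close> because the quadratic form of \<open>P\<close> has a positive minimum
  on the unit sphere and that of \<open>S\<close> is bounded below there.\<close>

lemma det_increasing_direction:
  fixes P S :: "real ^ 'n ^ 'n"
  assumes P: "pos_def P" and S: "transpose S = S" and H: "P ** H = mat 1" and tr: "trace (S ** H) > 0"
  obtains t0 where "t0 > 0" "\<And>t. 0 < t \<Longrightarrow> t < t0 \<Longrightarrow> pos_def (P + t *\<^sub>R S) \<and> det P < det (P + t *\<^sub>R S)"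
proof -
  have HP: "H ** P = mat 1" using H by (simp add: matrix_left_right_inverse)
  obtain t1 where t1: "t1 > 0" "\<And>t. 0 < t \<Longrightarrow> t < t1 \<Longrightarrow> 1 < det (mat 1 + t *\<^sub>R (S ** H))"
    using DERIV_pos_inc_right[OF det_has_derivative_at_mat_1 tr] by auto
  have det: "det P < det (P + t *\<^sub>R S)" if "0 < t" "t < t1" for t
  proof -
    have "P + t *\<^sub>R S = (mat 1 + t *\<^sub>R (S ** H)) ** P"
      by (simp add: matrix_add_rdistrib scalar_matrix_assoc[symmetric] matrix_mul_assoc[symmetric] HP)
    hence "det (P + t *\<^sub>R S) = det (mat 1 + t *\<^sub>R (S ** H)) * det P" by (simp add: det_mul)
    thus ?thesis using t1(2)[OF that] pos_def_det_pos[OF P] by simp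
  qed
  have cont: "continuous_on (sphere 0 1) (\<lambda>x. x \<bullet> (A *v x))" for A :: "real ^ 'n ^ 'n"
    by (intro continuous_intros)
  have ne: "sphere 0 1 \<noteq> ({} :: (real ^ 'n) set)" by simp
  obtain x0 where x0: "norm x0 = 1" and \<lambda>: "\<And>x. norm x = 1 \<Longrightarrow> x0 \<bullet> (P *v x0) \<le> x \<bullet> (P *v x)"
    using continuous_attains_inf[OF compact_sphere ne cont, of P] by auto
  obtain x1 where \<mu>: "\<And>x. norm x = 1 \<Longrightarrow> x1 \<bullet> (S *v x1) \<le> x \<bullet> (S *v x)"
    using continuous_attains_inf[OF compact_sphere ne cont, of S] by (metis mem_sphere_0)
  define l where "l = x0 \<bullet> (P *v x0)"
  define c where "c = \<bar>x1 \<bullet> (S *v x1)\<bar> + 1"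
  have "x0 \<noteq> 0" using x0 by auto
  hence l: "l > 0" using P by (simp add: l_def pos_def_def)
  have c: "c > 0" by (simp add: c_def)
  have pos: "pos_def (P + t *\<^sub>R S)" if t: "0 < t" "t < l / c" for t
    unfolding pos_def_def
  proof (intro conjI allI impI)
    show "transpose (P + t *\<^sub>R S) = P + t *\<^sub>R S"
      using P S by (simp add: transpose_add transpose_scalar pos_def_def)
    fix x :: "real ^ 'n" assume "x \<noteq> 0"
    define v where "v = x /\<^sub>R norm x"
    have v: "norm v = 1" "x = norm x *\<^sub>R v" using \<open>x \<noteq> 0\<close> by (simp_all add: v_def)
    have "t * c < l" using t c by (simp add: field_simps)
    moreover have "- c \<le> v \<bullet> (S *v v)" using \<mu>[OF v(1)] by (simp add: c_def)
    hence "t * - c \<le> t * (v \<bullet> (S *v v))" using t by (intro mult_left_mono) auto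
    moreover have "l \<le> v \<bullet> (P *v v)" using \<lambda>[OF v(1)] by (simp add: l_def)
    ultimately have "v \<bullet> ((P + t *\<^sub>R S) *v v) > 0"
      by (simp add: matrix_vector_mult_add_rdistrib scaleR_matrix_vector_assoc[symmetric] inner_add_right)
    hence "norm x * (norm x * (v \<bullet> ((P + t *\<^sub>R S) *v v))) > 0" using \<open>x \<noteq> 0\<close> by simp
    thus "x \<bullet> ((P + t *\<^sub>R S) *v x) > 0"
      by (subst (1 2) v(2)) (simp add: matrix_vector_mult_scaleR)
  qed
  show ?thesis
    by (rule that[of "min t1 (l / c)"]) (use t1 l c det pos in auto)
qed

text \<open>The normalisation \<open>(x - k) \<bullet> u = 1\<close> of the outer normals, instead of \<open>norm u = 1\<close>, makes
  the weights in the John decomposition sum to one.\<close>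

definition contact_pairs :: "(real ^ 'n) set \<Rightarrow> (real ^ 'n) set \<Rightarrow> real ^ 'n \<Rightarrow> ((real ^ 'n) \<times> (real ^ 'n)) set" where
  "contact_pairs K T k = {(x, u). x \<in> T \<and> (x - k) \<bullet> u = 1 \<and> (\<forall>y\<in>K. y \<bullet> u \<le> x \<bullet> u)}"

text \<open>The normals are bounded because a ball of radius \<open>r\<close> about \<open>k\<close>
  lies in \<open>K\<close>: testing \<open>u\<close> at the boundary point of that ball in direction
  \<open>u\<close> gives \<open>r * norm u \<le> 1\<close>. The remaining conditions are
  closed.\<close>

lemma compact_contact_pairs:
  fixes K T :: "(real ^ 'n) set"
  assumes T: "compact T" and k: "k \<in> interior K"
  shows "compact (contact_pairs K T k)"
proof -
  obtain r where r: "r > 0" "cball k r \<subseteq> K" using k by (auto simp: mem_interior_cball)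
  have "norm u \<le> 1 / r" if "(x, u) \<in> contact_pairs K T k" for x u
  proof (cases "u = 0")
    case False
    have "k + (r / norm u) *\<^sub>R u \<in> cball k r" using r False by (simp add: dist_norm)
    hence "(k + (r / norm u) *\<^sub>R u) \<bullet> u \<le> x \<bullet> u" using r that by (auto simp: contact_pairs_def)
    also have "\<dots> = 1 + k \<bullet> u" using that by (simp add: contact_pairs_def inner_diff_left)
    finally have "r * norm u \<le> 1"
      using False by (simp add: inner_add_left dot_square_norm power2_eq_square)
    thus ?thesis using r by (simp add: field_simps)
  qed (use r in simp)
  hence sub: "contact_pairs K T k \<subseteq> T \<times> cball 0 (1 / r)"
    by (auto simp: contact_pairs_def)
  have eq: "contact_pairs K T k = (T \<times> cball 0 (1 / r)) \<inter>
      ({p. (fst p - k) \<bullet> snd p = 1} \<inter> (\<Inter>y\<in>K. {p. y \<bullet> snd p \<le> fst p \<bullet> snd p}))"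
    using sub by (auto simp: contact_pairs_def)
  show ?thesis unfolding eq
    by (intro compact_Int_closed compact_Times T compact_cball closed_Int closed_INT ballI
        closed_Collect_eq closed_Collect_le continuous_intros)
qed

text \<open>If points moved along \<open>f\<close> left \<open>K\<close> for arbitrarily small
  times, separating them from \<open>K\<close> and passing to a limit of the points and unit normals
  would give a contact point with a supporting normal along which \<open>f\<close> does not point
  inward.\<close>

lemma move_inward:
  fixes K T :: "(real ^ 'n) set"
  assumes K: "convex_body K" and T: "compact T" "T \<subseteq> K" and k: "k \<in> interior K"
    and f: "continuous_on T f" and inward: "\<And>x u. (x, u) \<in> contact_pairs K T k \<Longrightarrow> f x \<bullet> u < 0"
  shows "\<exists>t0>0. \<forall>t x. 0 < t \<longrightarrow> t < t0 \<longrightarrow> x \<in> T \<longrightarrow> x + t *\<^sub>R f x \<in> K"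
proof (rule ccontr)
  assume contra: "\<not> ?thesis"
  have cl: "closed K" "convex K" using K by (auto simp: convex_body_def compact_imp_closed)
  have "\<exists>t x u. 0 < t \<and> t < 1 / real (Suc n) \<and> x \<in> T \<and> norm u = 1 \<and> (\<forall>y\<in>K. y \<bullet> u \<le> (x + t *\<^sub>R f x) \<bullet> u)" for n
  proof -
    obtain t x where tx: "0 < t" "t < 1 / real (Suc n)" "x \<in> T" "x + t *\<^sub>R f x \<notin> K"
      using contra by (metis of_nat_0_less_iff zero_less_Suc zero_less_divide_1_iff)
    obtain a b where a: "a \<bullet> (x + t *\<^sub>R f x) < b" "\<forall>y\<in>K. a \<bullet> y > b"
      using separating_hyperplane_closed_point[OF cl(2,1) tx(4)] by blast
    have "a \<noteq> 0" using a T tx by force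
    define u where "u = - (a /\<^sub>R norm a)"
    have "y \<bullet> u \<le> (x + t *\<^sub>R f x) \<bullet> u" if "y \<in> K" for y
    proof -
      have "a \<bullet> (x + t *\<^sub>R f x) \<le> a \<bullet> y" using a that by force
      hence "a \<bullet> (x + t *\<^sub>R f x) / norm a \<le> a \<bullet> y / norm a" by (simp add: divide_right_mono)
      thus ?thesis by (simp add: u_def inner_commute[of _ a] divide_inverse mult.commute)
    qed
    moreover have "norm u = 1" using \<open>a \<noteq> 0\<close> by (simp add: u_def)
    ultimately show ?thesis using tx by blast
  qed
  then obtain t x u where txu: "\<And>n. 0 < t n" "\<And>n. t n < 1 / real (Suc n)" "\<And>n. x n \<in> T"
    "\<And>n. norm (u n) = 1" "\<And>n y. y \<in> K \<Longrightarrow> y \<bullet> u n \<le> (x n + t n *\<^sub>R f (x n)) \<bullet> u n"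
    by metis
  have "seq_compact (T \<times> sphere (0 :: real ^ 'n) 1)"
    by (intro compact_imp_seq_compact compact_Times T compact_sphere)
  moreover have "\<forall>n. (x n, u n) \<in> T \<times> sphere 0 1" using txu(3,4) by simp
  ultimately obtain p \<sigma> where p: "p \<in> T \<times> sphere 0 1" and \<sigma>: "strict_mono (\<sigma> :: nat \<Rightarrow> nat)"
    and lim: "((\<lambda>n. (x n, u n)) \<circ> \<sigma>) \<longlonglongrightarrow> p"
    by (rule seq_compactE)
  obtain X U where XU: "p = (X, U)" by (cases p)
  have X: "X \<in> T" and U: "norm U = 1" using p XU by auto
  have limx: "(\<lambda>n. x (\<sigma> n)) \<longlonglongrightarrow> X" and limu: "(\<lambda>n. u (\<sigma> n)) \<longlonglongrightarrow> U"
    using tendsto_fst[OF lim] tendsto_snd[OF lim] by (simp_all add: XU o_def)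
  have limf: "(\<lambda>n. f (x (\<sigma> n))) \<longlonglongrightarrow> f X"
    using f X txu(3) limx by (auto intro: continuous_on_tendsto_compose)
  have "t \<longlonglongrightarrow> 0"
    by (rule tendsto_sandwich[OF _ _ tendsto_const LIMSEQ_inverse_real_of_nat])
       (use txu(1,2) in \<open>auto intro!: always_eventually less_imp_le simp: inverse_eq_divide\<close>)
  hence limt: "(\<lambda>n. t (\<sigma> n)) \<longlonglongrightarrow> 0"
    using LIMSEQ_subseq_LIMSEQ[OF _ \<sigma>] by (auto simp: o_def)
  have supp: "y \<bullet> U \<le> X \<bullet> U" if "y \<in> K" for y
  proof (rule tendsto_le)
    show "(\<lambda>n. y \<bullet> u (\<sigma> n)) \<longlonglongrightarrow> y \<bullet> U" by (intro tendsto_intros limu)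
    have "(\<lambda>n. (x (\<sigma> n) + t (\<sigma> n) *\<^sub>R f (x (\<sigma> n))) \<bullet> u (\<sigma> n)) \<longlonglongrightarrow> (X + 0 *\<^sub>R f X) \<bullet> U"
      by (intro tendsto_intros limx limt limf limu)
    thus "(\<lambda>n. (x (\<sigma> n) + t (\<sigma> n) *\<^sub>R f (x (\<sigma> n))) \<bullet> u (\<sigma> n)) \<longlonglongrightarrow> X \<bullet> U" by simp
  qed (use txu(5)[OF that] in auto)
  \<comment> \<open>The starting point \<open>x n\<close> lies in \<open>K\<close>, hence on the
    inner side of the hyperplane that separates the moved point from \<open>K\<close>.\<close>
  have "f (x n) \<bullet> u n \<ge> 0" for n
  proof -
    have "x n \<bullet> u n \<le> (x n + t n *\<^sub>R f (x n)) \<bullet> u n" using txu(3) T by (intro txu(5)) auto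
    thus ?thesis using txu(1)[of n] by (simp add: inner_add_left zero_le_mult_iff)
  qed
  moreover have "(\<lambda>n. f (x (\<sigma> n)) \<bullet> u (\<sigma> n)) \<longlonglongrightarrow> f X \<bullet> U"
    by (intro tendsto_inner limf limu)
  ultimately have nonneg: "f X \<bullet> U \<ge> 0"
    by (intro LIMSEQ_le_const[of "\<lambda>n. f (x (\<sigma> n)) \<bullet> u (\<sigma> n)"]) auto
  \<comment> \<open>The ball about \<open>k\<close> keeps \<open>(X - k) \<bullet> U\<close>
    positive, so the limit normal can be rescaled to satisfy the normalisation of
    \<open>contact_pairs\<close>.\<close>
  obtain r where r: "r > 0" "cball k r \<subseteq> K" using k by (auto simp: mem_interior_cball)
  have "k + r *\<^sub>R U \<in> cball k r" using r U by (simp add: dist_norm)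
  hence "(k + r *\<^sub>R U) \<bullet> U \<le> X \<bullet> U" using r by (intro supp) auto
  hence s: "(X - k) \<bullet> U > 0"
    using r U by (simp add: inner_add_left inner_diff_left dot_square_norm)
  define s where "s = (X - k) \<bullet> U"
  have "(X, U /\<^sub>R s) \<in> contact_pairs K T k"
    using X s supp by (auto simp: contact_pairs_def s_def[symmetric] intro!: mult_left_mono)
  from inward[OF this] have "f X \<bullet> U < 0"
    using s by (simp add: s_def[symmetric] zero_less_mult_iff mult_less_0_iff)
  with nonneg show False by simp
qed

text \<open>A linear functional \<open>A\<close> on symmetrised outer products acts only through
  \<open>A + transpose A\<close>. This converts a separating functional into a symmetric
  perturbation of the matrix.\<close>

lemma inner_symmetrized_outer:
  fixes A :: "real ^ 'n ^ 'n"
  shows "A \<bullet> (\<chi> i j. e $ i * u $ j + u $ i * e $ j) = u \<bullet> ((A + transpose A) *v e)"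
proof -
  have "A \<bullet> (\<chi> i j. e $ i * u $ j + u $ i * e $ j)
      = (\<Sum>i\<in>UNIV. \<Sum>j\<in>UNIV. A $ i $ j * e $ i * u $ j) + (\<Sum>i\<in>UNIV. \<Sum>j\<in>UNIV. A $ i $ j * u $ i * e $ j)"
    by (simp add: inner_vec_def distrib_left sum.distrib mult_ac)
  also have "(\<Sum>i\<in>UNIV. \<Sum>j\<in>UNIV. A $ i $ j * e $ i * u $ j) = (\<Sum>j\<in>UNIV. \<Sum>i\<in>UNIV. A $ i $ j * e $ i * u $ j)"
    by (rule sum.swap)
  also have "\<dots> + (\<Sum>i\<in>UNIV. \<Sum>j\<in>UNIV. A $ i $ j * u $ i * e $ j) = u \<bullet> ((A + transpose A) *v e)"
    by (simp add: inner_vec_def matrix_vector_mult_def transpose_def sum_distrib_left distrib_left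
        distrib_right sum.distrib mult_ac)
  finally show ?thesis .
qed

lemma inner_eq_trace:
  fixes A B :: "real ^ 'n ^ 'n"
  assumes "transpose B = B"
  shows "trace ((A + transpose A) ** B) = 2 * (A \<bullet> B)"
proof -
  have B: "B $ i $ j = B $ j $ i" for i j
    using assms by (metis transpose_def vec_lambda_beta)
  have "trace ((A + transpose A) ** B) = (\<Sum>i\<in>UNIV. \<Sum>j\<in>UNIV. A $ i $ j * B $ j $ i) + (\<Sum>i\<in>UNIV. \<Sum>j\<in>UNIV. A $ j $ i * B $ j $ i)"
    by (simp add: trace_def matrix_matrix_mult_def transpose_def distrib_right sum.distrib)
  also have "(\<Sum>i\<in>UNIV. \<Sum>j\<in>UNIV. A $ j $ i * B $ j $ i) = (\<Sum>j\<in>UNIV. \<Sum>i\<in>UNIV. A $ j $ i * B $ j $ i)"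
    by (rule sum.swap)
  finally show ?thesis using B by (simp add: inner_vec_def)
qed

text \<open>The first-order optimality condition (John decomposition). Only the symmetric part of
  \<open>\<Sum> c e u\<^sup>T\<close> is determined, because only symmetric perturbations of \<open>P\<close> are admissible.\<close>

lemma John_decomposition:
  fixes K M :: "(real ^ 'n) set" and P H :: "real ^ 'n ^ 'n"
  assumes K: "convex_body K" and M: "compact M" and max: "max_position K M P z"
    and k: "k \<in> interior K" and H: "P ** H = mat 1"
  obtains D c where "finite D" "D \<subseteq> contact_pairs K (affine_image P z M) k"
    "\<And>p. p \<in> D \<Longrightarrow> 0 \<le> c p" "sum c D = 1" "(\<Sum>p\<in>D. c p *\<^sub>R snd p) = 0"
    "\<And>i j. (\<Sum>p\<in>D. c p * ((H *v (fst p - k)) $ i * snd p $ j + snd p $ i * (H *v (fst p - k)) $ j))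
       = 2 / CARD('n) * H $ i $ j"
proof -
  define n where "n = real CARD('n)"
  have n: "n > 0" by (simp add: n_def)
  define T where "T = affine_image P z M"
  have P: "pos_def P" and TK: "T \<subseteq> K" using max by (auto simp: max_position_def T_def)
  have HP: "H ** P = mat 1" using H by (simp add: matrix_left_right_inverse)
  have H': "pos_def H"
    using pos_def_inverse[OF P] H by (metis matrix_mul_assoc matrix_mul_lid matrix_mul_rid)
  have T: "compact T"
    unfolding T_def affine_image_def by (intro compact_continuous_image continuous_intros M)
  define e where "e x = H *v (x - k)" for x
  define \<Phi> :: "(real ^ 'n) \<times> (real ^ 'n) \<Rightarrow> (real ^ 'n ^ 'n) \<times> (real ^ 'n)" where
    "\<Phi> p = ((\<chi> i j. e (fst p) $ i * snd p $ j + snd p $ i * e (fst p) $ j), snd p)" for p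
  have "continuous_on (contact_pairs K T k) \<Phi>"
    unfolding \<Phi>_def e_def matrix_mult_dot by (intro continuous_intros)
  hence comp: "compact (\<Phi> ` contact_pairs K T k)"
    by (intro compact_continuous_image compact_contact_pairs T k)
  \<comment> \<open>Membership in this hull is the claimed decomposition. If it failed, a separating
    functional \<open>(A, v)\<close> would give a perturbation of \<open>(P, z)\<close> that stays
    inside \<open>K\<close> and increases the determinant.\<close>
  have "((2 / n) *\<^sub>R H, 0) \<in> convex hull (\<Phi> ` contact_pairs K T k)"
  proof (rule ccontr)
    assume "\<not> ?thesis"
    then obtain a b where a: "a \<bullet> ((2 / n) *\<^sub>R H, 0) < b"
      "\<forall>q\<in>convex hull (\<Phi> ` contact_pairs K T k). a \<bullet> q > b"
      using separating_hyperplane_closed_point[OF convex_convex_hull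
          compact_imp_closed[OF compact_convex_hull[OF comp]]] by blast
    obtain A v where av: "a = (A, v)" by (cases a)
    define S0 where "S0 = A + transpose A"
    have tS0: "transpose S0 = S0" by (simp add: S0_def transpose_add add.commute)
    \<comment> \<open>The term \<open>b *\<^sub>R P\<close> absorbs the separation constant: it
      contributes exactly \<open>b\<close> at every contact pair, since
      \<open>P *v e x = x - k\<close> and \<open>(x - k) \<bullet> u = 1\<close>, and
      \<open>n * b\<close> to the trace. Both separation inequalities become sign conditions,
      \<open>f x \<bullet> u < 0\<close> and \<open>trace (S ** H) > 0\<close>.\<close>
    define S where "S = b *\<^sub>R P + - 1 *\<^sub>R S0"
    define f where "f x = S *v e x - v" for x
    have "trace (S0 ** H) < n * b"
      using a(1) n H' by (simp add: av S0_def inner_eq_trace pos_def_def field_simps)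
    moreover have "trace (S ** H) = n * b - trace (S0 ** H)"
      by (simp add: S_def matrix_diff_rdistrib trace_sub scalar_matrix_assoc[symmetric] H
          trace_scaleR trace_I n_def)
    ultimately have trS: "trace (S ** H) > 0" by simp
    have tS: "transpose S = S"
      using P tS0 unfolding S_def transpose_add transpose_scalar by (simp add: pos_def_def)
    have "f x \<bullet> u < 0" if xu: "(x, u) \<in> contact_pairs K T k" for x u
    proof -
      have "b < a \<bullet> \<Phi> (x, u)" using a(2) xu by (blast intro: hull_inc)
      hence "b < u \<bullet> (S0 *v e x) + v \<bullet> u"
        by (simp add: \<Phi>_def av inner_symmetrized_outer S0_def)
      moreover have "P *v e x = x - k"
        by (simp add: e_def matrix_vector_mul_assoc H)
      hence "u \<bullet> (P *v e x) = 1"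
        using xu by (simp add: contact_pairs_def inner_commute)
      ultimately show ?thesis
        by (simp add: f_def S_def matrix_vector_mult_diff_rdistrib inner_diff_left inner_diff_right
            scaleR_matrix_vector_assoc[symmetric] inner_commute[of _ u])
    qed
    moreover have "continuous_on T f"
      unfolding f_def e_def matrix_mult_dot by (intro continuous_intros)
    ultimately obtain t1 where t1: "t1 > 0" "\<And>t x. 0 < t \<Longrightarrow> t < t1 \<Longrightarrow> x \<in> T \<Longrightarrow> x + t *\<^sub>R f x \<in> K"
      using move_inward[OF K T TK k, of f] by metis
    obtain t2 where t2: "t2 > 0" "\<And>t. 0 < t \<Longrightarrow> t < t2 \<Longrightarrow> pos_def (P + t *\<^sub>R S) \<and> det P < det (P + t *\<^sub>R S)"
      using det_increasing_direction[OF P tS H trS] by metis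
    define t where "t = min t1 t2 / 2"
    have t: "0 < t" "t < t1" "t < t2" using t1 t2 by (auto simp: t_def)
    \<comment> \<open>The translation is chosen so that the perturbed map sends \<open>m\<close> to
      \<open>x + t *\<^sub>R f x\<close>, where \<open>x = P *v m + z\<close>.\<close>
    define z' where "z' = z + t *\<^sub>R (S *v (H *v (z - k)) - v)"
    have "(P + t *\<^sub>R S) *v m + z' \<in> K" if "m \<in> M" for m
    proof -
      have "H *v (P *v m) = m" by (simp add: matrix_vector_mul_assoc HP)
      hence "(P + t *\<^sub>R S) *v m + z' = (P *v m + z) + t *\<^sub>R f (P *v m + z)"
        by (simp add: z'_def f_def e_def matrix_vector_mult_add_rdistrib matrix_vector_right_distrib
            matrix_vector_mult_diff_distrib scaleR_matrix_vector_assoc[symmetric] algebra_simps)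
      moreover have "P *v m + z \<in> T" using that by (auto simp: T_def affine_image_def)
      ultimately show ?thesis using t1(2)[OF t(1,2)] by simp
    qed
    hence "affine_image (P + t *\<^sub>R S) z' M \<subseteq> K" by (auto simp: affine_image_def)
    hence "det (P + t *\<^sub>R S) \<le> det P" using max t2(2)[OF t(1,3)] unfolding max_position_def by blast
    with t2(2)[OF t(1,3)] show False by simp
  qed
  then obtain B w where B: "finite B" "B \<subseteq> \<Phi> ` contact_pairs K T k" "\<And>q. q \<in> B \<Longrightarrow> 0 \<le> w q"
    "sum w B = 1" "(\<Sum>q\<in>B. w q *\<^sub>R q) = ((2 / n) *\<^sub>R H, 0)"
    unfolding convex_hull_explicit by blast
  \<comment> \<open>Choosing one preimage for each point of \<open>B\<close> makes \<Phi> injective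
    on \<open>D\<close>, so the weights can be pulled back.\<close>
  obtain D where D: "D \<subseteq> contact_pairs K T k" "inj_on \<Phi> D" "B = \<Phi> ` D"
    using B(2) unfolding subset_image_inj by blast
  have sum: "(\<Sum>p\<in>D. w (\<Phi> p) *\<^sub>R \<Phi> p) = ((2 / n) *\<^sub>R H, 0)"
    using B(5) D by (simp add: sum.reindex)
  show ?thesis
  proof (rule that[of D "w \<circ> \<Phi>"])
    show "finite D" using B(1) D by (simp add: finite_image_iff)
    show "D \<subseteq> contact_pairs K (affine_image P z M) k" using D by (simp add: T_def)
    show "0 \<le> (w \<circ> \<Phi>) p" if "p \<in> D" for p using B(3) D that by auto
    show "sum (w \<circ> \<Phi>) D = 1" using B(4) D by (simp add: sum.reindex)
    have "(\<Sum>p\<in>D. w (\<Phi> p) *\<^sub>R snd (\<Phi> p)) = 0"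
      using arg_cong[OF sum, of snd] by (simp add: snd_sum)
    thus "(\<Sum>p\<in>D. (w \<circ> \<Phi>) p *\<^sub>R snd p) = 0" by (simp add: \<Phi>_def)
    fix i j
    have "(\<Sum>p\<in>D. w (\<Phi> p) *\<^sub>R fst (\<Phi> p)) $ i $ j = 2 / n * H $ i $ j"
      using arg_cong[OF sum, of fst] by (simp add: fst_sum)
    thus "(\<Sum>p\<in>D. (w \<circ> \<Phi>) p * ((H *v (fst p - k)) $ i * snd p $ j + snd p $ i * (H *v (fst p - k)) $ j))
       = 2 / CARD('n) * H $ i $ j"
      by (simp add: \<Phi>_def e_def n_def)
  qed
qed

section \<open>Saddle-John images\<close>

theorem proposition4p4:
  fixes K L Ls :: "(real ^ 'n) set"
    and P U :: "real ^ 'n ^ 'n" and z :: "real ^ 'n"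
  assumes "convex_body K" and "convex_body L"
    and "saddle_John K L P U z"
    and "Ls = affine_image P z ((\<lambda>x. U *v x) ` L)"
  shows "\<exists>a. (\<lambda>x. x - a) ` K \<subseteq> (\<lambda>x. - real CARD('n) *\<^sub>R (x - a)) ` Ls"
proof -
  note K = assms(1) and L = assms(2)
  define n where "n = real CARD('n)"
  have n: "n > 0" by (simp add: n_def)
  have U: "orthogonal_matrix U" and P: "pos_def P" and Pz: "P_star K L U = P" "z_star K L U = z"
    and saddle: "\<And>V. orthogonal_matrix V \<Longrightarrow> det P \<le> det (P_star K L V)"
    using assms(3) by (auto simp: saddle_John_def)
  define M where "M = (*v) U ` L"
  have M: "convex_body M" unfolding M_def by (rule convex_body_orthogonal_image[OF U L])
  have Ls: "Ls = affine_image P z M" using assms(4) by (simp add: M_def)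
  have max: "max_position K M P z" using John_pair_eq[OF K L U] by (simp add: Pz M_def)
  obtain k where k: "k \<in> interior K" using K by (auto simp: convex_body_def)
  obtain H where H: "pos_def H" "P ** H = mat 1" "H ** P = mat 1" by (rule pos_def_inverse[OF P]) blast
  have cM: "compact M" using M by (simp add: convex_body_def)
  obtain D c where D: "finite D" "D \<subseteq> contact_pairs K Ls k"
    and c: "\<And>p. p \<in> D \<Longrightarrow> 0 \<le> c p" "sum c D = 1"
    and cu: "(\<Sum>p\<in>D. c p *\<^sub>R snd p) = 0"
    and sym: "\<And>i j. (\<Sum>p\<in>D. c p * ((H *v (fst p - k)) $ i * snd p $ j + snd p $ i * (H *v (fst p - k)) $ j))
       = 2 / n * H $ i $ j"
    by (rule John_decomposition[OF K cM max k H(2), folded Ls n_def]) (rule that; (assumption | blast))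
  have contact: "fst p \<in> Ls" "(fst p - k) \<bullet> snd p = 1" "\<And>y. y \<in> K \<Longrightarrow> y \<bullet> snd p \<le> fst p \<bullet> snd p" if "p \<in> D" for p
    using D(2) that by (auto simp: contact_pairs_def)
  have cu': "(\<Sum>p\<in>D. c p * (v \<bullet> snd p)) = 0" for v
  proof -
    have "(\<Sum>p\<in>D. c p * (v \<bullet> snd p)) = v \<bullet> (\<Sum>p\<in>D. c p *\<^sub>R snd p)" by (simp add: inner_sum_right)
    thus ?thesis by (simp add: cu)
  qed
  \<comment> \<open>These are the contact points pulled back to \<open>M\<close>, up to the fixed
    translation by \<open>H *v (z - k)\<close>.\<close>
  define e where "e p = H *v (fst p - k)" for p :: "(real ^ 'n) \<times> (real ^ 'n)"
  define N where "N = (\<chi> i j. n * (\<Sum>p\<in>D. c p * (e p $ i * snd p $ j)))"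
  have trace_N: "trace (B ** N) = n * (\<Sum>p\<in>D. c p * (snd p \<bullet> (B *v e p)))" for B
  proof -
    have "trace (B ** N) = (\<Sum>i\<in>UNIV. \<Sum>j\<in>UNIV. \<Sum>p\<in>D. n * (c p * (snd p $ i * (B $ i $ j * e p $ j))))"
      by (simp add: trace_def matrix_matrix_mult_def N_def sum_distrib_left mult_ac)
    also have "\<dots> = (\<Sum>i\<in>UNIV. \<Sum>p\<in>D. \<Sum>j\<in>UNIV. n * (c p * (snd p $ i * (B $ i $ j * e p $ j))))"
      by (intro sum.cong refl sum.swap)
    also have "\<dots> = (\<Sum>p\<in>D. \<Sum>i\<in>UNIV. \<Sum>j\<in>UNIV. n * (c p * (snd p $ i * (B $ i $ j * e p $ j))))"
      by (rule sum.swap)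
    also have "\<dots> = n * (\<Sum>p\<in>D. c p * (snd p \<bullet> (B *v e p)))"
      by (simp add: inner_vec_def matrix_vector_mult_def sum_distrib_left)
    finally show ?thesis .
  qed
  \<comment> \<open>The decomposition says that \<open>H\<close> is the symmetric part of
    \<open>N\<close>, so \<open>Y\<close> is the skew part, which maximality of \<open>P\<close>
    alone does not control.\<close>
  define Y where "Y = N - H"
  have N: "N = H + Y" by (simp add: Y_def)
  have "N $ i $ j + N $ j $ i = 2 * H $ i $ j" for i j
  proof -
    have "N $ i $ j + N $ j $ i = n * (\<Sum>p\<in>D. c p * (e p $ i * snd p $ j + snd p $ i * e p $ j))"
      by (simp add: N_def distrib_left sum.distrib mult_ac)
    also have "\<dots> = 2 * H $ i $ j" using n unfolding e_def sym by simp
    finally show ?thesis .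
  qed
  moreover have "H $ i $ j = H $ j $ i" for i j
    using H(1) unfolding pos_def_def by (metis transpose_def vec_lambda_beta)
  ultimately have tY: "transpose Y = - Y"
    by (simp add: Y_def transpose_def vec_eq_iff) (smt (verit))
  have "Y = 0"
  proof (rule ccontr)
    assume "Y \<noteq> 0"
    have detN: "det H < \<bar>det N\<bar>" unfolding N by (rule det_add_skew[OF H(1) tY \<open>Y \<noteq> 0\<close>])
    have detH: "det H > 0" by (rule pos_def_det_pos[OF H(1)])
    have "invertible N" using detN detH by (simp add: invertible_det_nz)
    then obtain R where R: "orthogonal_matrix R" "pos_def (R ** N)" by (rule polar_decomposition)
    have "\<bar>det R\<bar> = 1" using det_orthogonal_matrix[OF R(1)] by auto
    hence "\<bar>det (R ** N)\<bar> = \<bar>det N\<bar>" by (simp add: det_mul abs_mult)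
    hence detRN: "det (R ** N) > det H" using pos_def_det_pos[OF R(2)] detN by simp
    define V where "V = R ** U"
    have V: "orthogonal_matrix V" unfolding V_def by (rule orthogonal_matrix_mul[OF R(1) U])
    define Q where "Q = P_star K L V"
    define w where "w = z_star K L V"
    have Qw: "max_position K ((*v) V ` L) Q w" unfolding Q_def w_def by (rule John_pair_eq[OF K L V])
    have Q: "pos_def Q" using Qw by (simp add: max_position_def)
    \<comment> \<open>The saddle condition gives \<open>det Q \<ge> det P\<close>, and the skew part
      makes \<open>det (R ** N)\<close> strictly larger than \<open>det H\<close>. The product of
      determinants thus exceeds 1.\<close>
    have "1 = det P * det H" using det_inverse_mult[OF H(2)] by simp
    also have "\<dots> \<le> det Q * det H"
      using saddle[OF V] detH by (simp add: Q_def)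
    also have "\<dots> < det Q * det (R ** N)"
      using detRN pos_def_det_pos[OF Q] by simp
    finally have "ln (det Q * det (R ** N)) > 0" by simp
    hence gt: "trace (Q ** (R ** N)) > n"
      using trace_mult_ge(1)[OF Q R(2)] by (simp add: n_def)
    define g where "g = H *v (z - k)"
    \<comment> \<open>The point of \<open>M\<close> behind the contact point is mapped by the John
      pair of \<open>V\<close> into \<open>K\<close>, and is therefore bounded in the direction of
      the normal. All translations are collected in one vector independent of \<open>p\<close>,
      whose contribution vanishes after weighting because the weighted normals sum to 0.\<close>
    have bound: "snd p \<bullet> ((Q ** R) *v e p) \<le> 1 + ((k - w + (Q ** R) *v g) \<bullet> snd p)" if p: "p \<in> D" for p
    proof -
      obtain l where l: "l \<in> L" "fst p = P *v (U *v l) + z"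
        using contact(1)[OF p] by (auto simp: Ls M_def affine_image_def)
      have "H *v (P *v (U *v l)) = U *v l" by (metis H(3) matrix_vector_mul_assoc matrix_vector_mul_lid)
      hence "e p = U *v l + g"
        by (simp add: e_def g_def l(2) matrix_vector_right_distrib matrix_vector_mult_diff_distrib)
      hence e: "(Q ** R) *v e p = (Q *v (V *v l) + w) - w + (Q ** R) *v g"
        by (simp add: V_def matrix_vector_right_distrib matrix_vector_mul_assoc matrix_mul_assoc)
      have "Q *v (V *v l) + w \<in> K"
        using Qw l(1) by (auto simp: max_position_def affine_image_def)
      from contact(3)[OF p this] contact(2)[OF p]
      have "(Q *v (V *v l) + w) \<bullet> snd p \<le> 1 + k \<bullet> snd p" by (simp add: inner_diff_left)
      thus ?thesis unfolding e by (simp add: inner_commute[of "snd p"] inner_add_left inner_diff_left)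
    qed
    have "(\<Sum>p\<in>D. c p * (snd p \<bullet> ((Q ** R) *v e p)))
        \<le> (\<Sum>p\<in>D. c p * (1 + ((k - w + (Q ** R) *v g) \<bullet> snd p)))"
      using bound c by (intro sum_mono mult_left_mono) auto
    also have "\<dots> = 1"
      by (simp only: distrib_left sum.distrib mult_1_right c(2) cu' add_0_right)
    finally have "trace ((Q ** R) ** N) \<le> n"
      unfolding trace_N using n by (simp add: mult_left_le)
    with gt show False by (simp add: matrix_mul_assoc)
  qed
  hence NH: "N = H" using N by simp
  \<comment> \<open>With \<open>N = H\<close>, applying \<open>N\<close> to \<open>y\<close>
    expresses \<open>H *v y\<close> through the pulled-back contact points, and \<open>P\<close>
    cancels \<open>H\<close>. The terms with \<open>k\<close> vanish because the weighted normals
    sum to 0.\<close>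
  have decomposition: "(\<Sum>p\<in>D. (c p * (y \<bullet> snd p)) *\<^sub>R fst p) = (1 / n) *\<^sub>R y" for y
  proof -
    have "H *v y = n *\<^sub>R (\<Sum>p\<in>D. (c p * (y \<bullet> snd p)) *\<^sub>R e p)"
    proof -
      have "(H *v y) $ i = (\<Sum>j\<in>UNIV. \<Sum>p\<in>D. n * (c p * (y $ j * snd p $ j) * e p $ i))" for i
        by (simp add: NH[symmetric] N_def matrix_vector_mult_def sum_distrib_left sum_distrib_right mult_ac)
      also have "\<dots> i = (\<Sum>p\<in>D. \<Sum>j\<in>UNIV. n * (c p * (y $ j * snd p $ j) * e p $ i))" for i
        by (rule sum.swap)
      finally show ?thesis
        by (simp add: vec_eq_iff inner_vec_def sum_distrib_left sum_distrib_right)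
    qed
    also have "\<dots> = H *v (n *\<^sub>R (\<Sum>p\<in>D. (c p * (y \<bullet> snd p)) *\<^sub>R (fst p - k)))"
      by (simp add: e_def linear_sum[OF matrix_vector_mul_linear] matrix_vector_mult_scaleR o_def)
    finally have "P *v (H *v y) = P *v (H *v (n *\<^sub>R (\<Sum>p\<in>D. (c p * (y \<bullet> snd p)) *\<^sub>R (fst p - k))))"
      by (rule arg_cong)
    hence "y = n *\<^sub>R (\<Sum>p\<in>D. (c p * (y \<bullet> snd p)) *\<^sub>R (fst p - k))"
      by (simp only: matrix_vector_mul_assoc H(2) matrix_vector_mul_lid)
    also have "(\<Sum>p\<in>D. (c p * (y \<bullet> snd p)) *\<^sub>R (fst p - k))
        = (\<Sum>p\<in>D. (c p * (y \<bullet> snd p)) *\<^sub>R fst p) - (\<Sum>p\<in>D. c p * (y \<bullet> snd p)) *\<^sub>R k"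
      by (simp add: scaleR_diff_right sum_subtractf scaleR_sum_left)
    finally have "y = n *\<^sub>R (\<Sum>p\<in>D. (c p * (y \<bullet> snd p)) *\<^sub>R fst p)" by (simp add: cu')
    hence "(1 / n) *\<^sub>R y = (1 / n) *\<^sub>R n *\<^sub>R (\<Sum>p\<in>D. (c p * (y \<bullet> snd p)) *\<^sub>R fst p)" by (rule arg_cong)
    thus ?thesis using n by simp
  qed
  have Lsconv: "convex Ls"
  proof -
    have "Ls = (+) z ` (*v) P ` M" by (auto simp: Ls affine_image_def image_image add.commute)
    thus ?thesis using M by (auto simp: convex_body_def intro!: convex_translation convex_linear_image)
  qed
  define m where "m = (\<Sum>p\<in>D. (c p * (fst p \<bullet> snd p)) *\<^sub>R fst p)"
  have inLs: "m - (1 / n) *\<^sub>R y \<in> Ls" if y: "y \<in> K" for y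
  proof -
    \<comment> \<open>The coefficients are convex weights: each is nonnegative since the normal
      attains its maximum over \<open>K\<close> at the contact point, and they sum to 1 by the
      normalisation and the vanishing of the weighted normals.\<close>
    have "m - (1 / n) *\<^sub>R y = (\<Sum>p\<in>D. (c p * ((fst p - y) \<bullet> snd p)) *\<^sub>R fst p)"
      by (simp add: m_def decomposition[symmetric] inner_diff_left right_diff_distrib scaleR_diff_left sum_subtractf)
    also have "\<dots> \<in> Ls"
    proof (rule convex_sum[OF D(1) Lsconv])
      have "(\<Sum>p\<in>D. c p * ((fst p - y) \<bullet> snd p)) = (\<Sum>p\<in>D. c p * (1 + (k - y) \<bullet> snd p))"
      proof (intro sum.cong refl)
        show "c p * ((fst p - y) \<bullet> snd p) = c p * (1 + (k - y) \<bullet> snd p)" if "p \<in> D" for p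
          using contact(2)[OF that] by (simp add: inner_diff_left algebra_simps)
      qed
      also have "\<dots> = 1"
        by (simp only: distrib_left sum.distrib mult_1_right c(2) cu' add_0_right)
      finally show "(\<Sum>p\<in>D. c p * ((fst p - y) \<bullet> snd p)) = 1" .
      show "0 \<le> c p * ((fst p - y) \<bullet> snd p)" if "p \<in> D" for p
        using c(1)[OF that] contact(3)[OF that y] by (simp add: inner_diff_left)
    qed (use contact(1) in auto)
    finally show ?thesis .
  qed
  \<comment> \<open>This is the solution of
    \<open>y - a = - n *\<^sub>R (m - (1 / n) *\<^sub>R y - a)\<close>, in which \<open>y\<close>
    cancels.\<close>
  define a where "a = (n / (n + 1)) *\<^sub>R m"
  have a: "n *\<^sub>R m = (n + 1) *\<^sub>R a" using n by (simp add: a_def)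
  have "y - a \<in> (\<lambda>x. - real CARD('n) *\<^sub>R (x - a)) ` Ls" if "y \<in> K" for y
  proof (rule image_eqI[OF _ inLs[OF that]])
    have "- n *\<^sub>R (m - (1 / n) *\<^sub>R y - a) = y + n *\<^sub>R a - n *\<^sub>R m"
      using n by (simp add: scaleR_diff_right)
    also have "\<dots> = y - a" unfolding a by (simp add: scaleR_add_left)
    finally show "y - a = - real CARD('n) *\<^sub>R (m - (1 / n) *\<^sub>R y - a)" by (simp add: n_def)
  qed
  thus ?thesis by blast
qed

end
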